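(* Assume that one of the hypotheses (Sub), (Sup-1), (Sup-0), (Crit-1), (Crit-2), (Crit-3) described in the context holds. For $K\in\mathbb N$ let $\tilde\nu_K:=\liminf_{N\to\infty}\frac1N\mathbb E_N\big(\sum_{j>K}jC_j\big)$ and $\tilde\nu:=\lim_{K\to\infty}\tilde\nu_K$. Then for each $K\in\mathbb N$ the limit $\lim_{N\to\infty}\frac1N\mathbb E_N\big(\sum_{j>K}jC_j\big)$ exists and $$\tilde\nu_K=\lim_{N\to\infty}\frac1N\mathbb E_N\Big(\sum_{j>K}jC_j\Big)=1-\sum_{j=1}^K\kappa_j r_*^j,$$ and moreover $\tilde\nu=0$ if $g_\kappa^{\{1\}}(R)\ge1$, while $\tilde\nu=1-g_\kappa^{\{1\}}(R)>0$ if $g_\kappa^{\{1\}}(R)<1$.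
   Context: Model: for $N\in\mathbb N$, $S_N$ is the symmetric group on $\{1,\dots,N\}$; for $\sigma\in S_N$, $C_j=C_j(\sigma)$ is the number of cycles of length $j$ in $\sigma$. Given sequences of nonnegative reals $(\theta_j)_{j\ge1}$, $(\kappa_j)_{j\ge1}$, the probability measure $\mathbb P_N$ on $S_N$ is $\mathbb P_N(\sigma)=\frac{1}{N!H_N}\prod_{j=1}^N(\theta_j+N\kappa_j)^{C_j}$ with $H_N=\frac1{N!}\sum_{\sigma\in S_N}\prod_{j=1}^N(\theta_j+N\kappa_j)^{C_j}$; $\mathbb E_N$ is the expectation. Generating functions: $g_\theta(z)=\sum_{j\ge1}\theta_jz^j/j$, $g_\kappa(z)=\sum_{j\ge1}\kappa_jz^j/j$. For a function $g$, $g^{\{n\}}(z):=z^n g^{(n)}(z)$. $R\in(0,\infty]$ is the radius of convergence of $g_\kappa$, and $g_\kappa^{\{n\}}(R):=\lim_{r\uparrow R}g_\kappa^{\{n\}}(r)\in[0,\infty]$. Standing assumption: $(\kappa_j)$ is non-arithmetic (there is no integer $j_0>1$ such that $\kappa_j\ne0$ implies that $j_0$ divides $j$) and $\kappa_j>0$ for some $j\ge2$. For $\eta>0$, $\varphi\in(0,\pi/2)$, $\Delta_0=\{z\in\mathbb C:|z|<R|1+\eta e^{i\varphi}|,\ z\ne R,\ |\arg(z-R)|>\varphi\}$; "holomorphic in some $\Delta_0$" means for some such $\eta,\varphi$. Logarithms and non-integer powers of $1-z/R$ use principal branches. Hypotheses: (Sub) $g_\theta,g_\kappa$ both have radius of convergence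 $R>0$ and $1<g_\kappa^{\{1\}}(R)\le\infty$. (Sup-1) $g_\theta,g_\kappa$ both have radius of convergence $R>0$, are holomorphic in some $\Delta_0$, $g_\kappa^{\{1\}}(R)<1$, and as $z\to R$, $z\in\Delta_0$: $g_\theta(z)=-\theta^*\log(1-z/R)+O((1-z/R)^\delta)$ and $g_\kappa(z)=g_\kappa(R)-g_\kappa^{\{1\}}(R)(1-z/R)+O((1-z/R)^{1+\delta})$, for some $\theta^*>0$, $\delta>0$. (Sup-0) $g_\kappa$ has radius of convergence $R>0$ and is holomorphic in some $\Delta_0$, $g_\kappa^{\{1\}}(R)<1$, there is a non-integer $s>1$ with $g_\kappa^{\{n\}}(R)<\infty$ for all integers $n<s$ and $g_\kappa^{\{n\}}(R)=\infty$ for $n>s$, and as $z\to R$, $z\in\Delta_0$, $g_\kappa(z)=\sum_{0\le n<s}\frac{(-1)^ng_\kappa^{\{n\}}(R)}{n!}(1-z/R)^n+a_s(1-z/R)^s+O((1-z/R)^{s+\delta})$ with $a_s>0$, $\delta>0$; $g_\theta$ is holomorphic in $\Delta_0$ and regular (holomorphic in a neighbourhood of) at $z=R$. (Crit-1) $g_\theta,g_\kappa$ both have radius of convergence $R>0$, $g_\theta(R)<\infty$, $g_\kappa(R)<\infty$, $g_\kappa^{\{1\}}(R)=1$, $0<g_\kappa^{\{2\}}(R)<\infty$. (Crit-2) $g_\theta,g_\kappa$ both have radius of convergence $R>0$ and are holomorphic in some $\Delta_0$, $g_\kappa^{\{1\}}(R)=1$, $0<g_\kappa^{\{2\}}(R)<\infty$,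 and as $z\to R$, $z\in\Delta_0$: $g_\theta(z)=-\theta^*\log(1-z/R)+O((1-z/R)^\delta)$ with $\theta^*\ge0$, $\delta>0$, and $g_\kappa(z)=g_\kappa(R)-(1-z/R)+\frac12 g_\kappa^{\{2\}}(R)(1-z/R)^2+O((1-z/R)^{2+\delta})$. (Crit-3) as (Crit-2) but without the condition on $g_\kappa^{\{2\}}(R)$ and with the expansion of $g_\kappa$ replaced by $g_\kappa(z)=g_\kappa(R)-(1-z/R)+a_s(1-z/R)^s+O((1-z/R)^{s+\delta})$ with $s\in(1,2)$, $a_s>0$. Definition of $r_*$: if $g_\kappa^{\{1\}}(R)\ge1$, $r_*=r_1$, the unique $r\in(0,R]$ with $g_\kappa^{\{1\}}(r)=1$; if $g_\kappa^{\{1\}}(R)<1$, $r_*=R$. *)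

theory Defs
  imports "HOL-Analysis.Analysis" "HOL-Library.Landau_Symbols" "HOL-Combinatorics.Orbits"
begin

text \<open>Sequences theta, kappa are indexed by j \<ge> 1 (the value at 0 is irrelevant).\<close>

definition perms :: "nat \<Rightarrow> (nat \<Rightarrow> nat) set" where
  "perms N = {\<sigma>. \<sigma> permutes {1..N}}"

definition cyc_count :: "nat \<Rightarrow> (nat \<Rightarrow> nat) \<Rightarrow> nat \<Rightarrow> nat" where
  "cyc_count N \<sigma> j = card {orbit \<sigma> x | x. x \<in> {1..N} \<and> card (orbit \<sigma> x) = j}"

definition weight :: "(nat \<Rightarrow> real) \<Rightarrow> (nat \<Rightarrow> real) \<Rightarrow> nat \<Rightarrow> (nat \<Rightarrow> nat) \<Rightarrow> real" where
  "weight \<theta> \<kappa> N \<sigma> = (\<Prod>j=1..N. (\<theta> j + real N * \<kappa> j) ^ cyc_count N \<sigma> j)"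

definition H_N :: "(nat \<Rightarrow> real) \<Rightarrow> (nat \<Rightarrow> real) \<Rightarrow> nat \<Rightarrow> real" where
  "H_N \<theta> \<kappa> N = (1 / fact N) * (\<Sum>\<sigma>\<in>perms N. weight \<theta> \<kappa> N \<sigma>)"

definition prob_N :: "(nat \<Rightarrow> real) \<Rightarrow> (nat \<Rightarrow> real) \<Rightarrow> nat \<Rightarrow> (nat \<Rightarrow> nat) \<Rightarrow> real" where
  "prob_N \<theta> \<kappa> N \<sigma> = weight \<theta> \<kappa> N \<sigma> / (fact N * H_N \<theta> \<kappa> N)"

definition expect_N :: "(nat \<Rightarrow> real) \<Rightarrow> (nat \<Rightarrow> real) \<Rightarrow> nat \<Rightarrow> ((nat \<Rightarrow> nat) \<Rightarrow> real) \<Rightarrow> real" where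
  "expect_N \<theta> \<kappa> N f = (\<Sum>\<sigma>\<in>perms N. prob_N \<theta> \<kappa> N \<sigma> * f \<sigma>)"

text \<open>The quantity (1/N) E_N (sum_{j>K} j C_j); cycles have length at most N.\<close>
definition tail_mass :: "(nat \<Rightarrow> real) \<Rightarrow> (nat \<Rightarrow> real) \<Rightarrow> nat \<Rightarrow> nat \<Rightarrow> real" where
  "tail_mass \<theta> \<kappa> K N =
     expect_N \<theta> \<kappa> N (\<lambda>\<sigma>. \<Sum>j\<in>{K<..N}. real j * real (cyc_count N \<sigma> j)) / real N"

definition gcoeff :: "(nat \<Rightarrow> real) \<Rightarrow> nat \<Rightarrow> real" where
  "gcoeff a j = (if j = 0 then 0 else a j / real j)"

definition radius :: "(nat \<Rightarrow> real) \<Rightarrow> ereal" where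
  "radius a = conv_radius (gcoeff a)"

text \<open>g_a as a complex power series (meaningful inside the disc of convergence)\<close>
definition gC :: "(nat \<Rightarrow> real) \<Rightarrow> complex \<Rightarrow> complex" where
  "gC a z = (\<Sum>j. of_real (gcoeff a j) * z ^ j)"

definition gR :: "(nat \<Rightarrow> real) \<Rightarrow> real \<Rightarrow> real" where
  "gR a x = (\<Sum>j. gcoeff a j * x ^ j)"

definition gder :: "(nat \<Rightarrow> real) \<Rightarrow> nat \<Rightarrow> real \<Rightarrow> real" where
  "gder a n r = r ^ n * (deriv ^^ n) (gR a) r"

definition gderR :: "(nat \<Rightarrow> real) \<Rightarrow> nat \<Rightarrow> ereal" where
  "gderR a n = (let R = radius a in
     Lim (if R = \<infinity> then at_top else at_left (real_of_ereal R)) (\<lambda>r. ereal (gder a n r)))"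

definition gder_ext :: "(nat \<Rightarrow> real) \<Rightarrow> nat \<Rightarrow> real \<Rightarrow> ereal" where
  "gder_ext a n r = (if ereal r = radius a then gderR a n else ereal (gder a n r))"

definition Delta0 :: "real \<Rightarrow> real \<Rightarrow> real \<Rightarrow> complex set" where
  "Delta0 R \<eta> \<phi> = {z. cmod z < R * cmod (1 + of_real \<eta> * exp (\<i> * of_real \<phi>))
                        \<and> z \<noteq> of_real R \<and> \<bar>Arg (z - of_real R)\<bar> > \<phi>}"

text \<open>G is the holomorphic continuation of g_a to the set S (which contains the disc of radius R)\<close>
definition hol_cont :: "(nat \<Rightarrow> real) \<Rightarrow> real \<Rightarrow> complex set \<Rightarrow> (complex \<Rightarrow> complex) \<Rightarrow> bool" where
  "hol_cont a R S G \<longleftrightarrow> ereal R \<le> radius a \<and> G holomorphic_on S \<and> (\<forall>z\<in>ball 0 R. G z = gC a z)"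

definition u :: "real \<Rightarrow> complex \<Rightarrow> complex" where
  "u R z = 1 - z / of_real R"

definition std_assms :: "(nat \<Rightarrow> real) \<Rightarrow> (nat \<Rightarrow> real) \<Rightarrow> bool" where
  "std_assms \<theta> \<kappa> \<longleftrightarrow> (\<forall>j\<ge>1. \<theta> j \<ge> 0 \<and> \<kappa> j \<ge> 0)
     \<and> \<not> (\<exists>j0>1. \<forall>j\<ge>1. \<kappa> j \<noteq> 0 \<longrightarrow> j0 dvd j)
     \<and> (\<exists>j\<ge>2. \<kappa> j > 0)"

definition hyp_Sub :: "(nat \<Rightarrow> real) \<Rightarrow> (nat \<Rightarrow> real) \<Rightarrow> bool" where
  "hyp_Sub \<theta> \<kappa> \<longleftrightarrow> radius \<theta> = radius \<kappa> \<and> radius \<kappa> > 0 \<and> 1 < gderR \<kappa> 1"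

definition hyp_Sup1 :: "(nat \<Rightarrow> real) \<Rightarrow> (nat \<Rightarrow> real) \<Rightarrow> bool" where
  "hyp_Sup1 \<theta> \<kappa> \<longleftrightarrow> (\<exists>R \<eta> \<phi> G\<theta> G\<kappa> \<theta>s \<delta> c0 c1.
     R > 0 \<and> radius \<theta> = ereal R \<and> radius \<kappa> = ereal R \<and> \<eta> > 0 \<and> 0 < \<phi> \<and> \<phi> < pi/2 \<and>
     hol_cont \<theta> R (Delta0 R \<eta> \<phi>) G\<theta> \<and> hol_cont \<kappa> R (Delta0 R \<eta> \<phi>) G\<kappa> \<and>
     gderR \<kappa> 1 = ereal c1 \<and> c1 < 1 \<and> gderR \<kappa> 0 = ereal c0 \<and> \<theta>s > 0 \<and> \<delta> > 0 \<and>
     (\<lambda>z. G\<theta> z - (- of_real \<theta>s * Ln (u R z)))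
        \<in> O[at (of_real R) within Delta0 R \<eta> \<phi>](\<lambda>z. u R z powr of_real \<delta>) \<and>
     (\<lambda>z. G\<kappa> z - (of_real c0 - of_real c1 * u R z))
        \<in> O[at (of_real R) within Delta0 R \<eta> \<phi>](\<lambda>z. u R z powr of_real (1 + \<delta>)))"

definition hyp_Sup0 :: "(nat \<Rightarrow> real) \<Rightarrow> (nat \<Rightarrow> real) \<Rightarrow> bool" where
  "hyp_Sup0 \<theta> \<kappa> \<longleftrightarrow> (\<exists>R \<eta> \<phi> \<epsilon> G\<theta> G\<kappa> s c a_s \<delta>.
     R > 0 \<and> radius \<kappa> = ereal R \<and> \<eta> > 0 \<and> 0 < \<phi> \<and> \<phi> < pi/2 \<and> \<epsilon> > 0 \<and>
     hol_cont \<kappa> R (Delta0 R \<eta> \<phi>) G\<kappa> \<and>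
     hol_cont \<theta> R (Delta0 R \<eta> \<phi> \<union> ball (of_real R) \<epsilon>) G\<theta> \<and>
     gderR \<kappa> 1 < 1 \<and> s > 1 \<and> s \<notin> \<int> \<and>
     (\<forall>n::nat. real n < s \<longrightarrow> gderR \<kappa> n = ereal (c n)) \<and>
     (\<forall>n::nat. real n > s \<longrightarrow> gderR \<kappa> n = \<infinity>) \<and> a_s > 0 \<and> \<delta> > 0 \<and>
     (\<lambda>z. G\<kappa> z - ((\<Sum>n\<in>{n::nat. real n < s}. of_real ((-1) ^ n * c n / fact n) * u R z ^ n)
                     + of_real a_s * u R z powr of_real s))
        \<in> O[at (of_real R) within Delta0 R \<eta> \<phi>](\<lambda>z. u R z powr of_real (s + \<delta>)))"

definition hyp_Crit1 :: "(nat \<Rightarrow> real) \<Rightarrow> (nat \<Rightarrow> real) \<Rightarrow> bool" where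
  "hyp_Crit1 \<theta> \<kappa> \<longleftrightarrow> radius \<theta> = radius \<kappa> \<and> radius \<kappa> > 0 \<and>
     gderR \<theta> 0 < \<infinity> \<and> gderR \<kappa> 0 < \<infinity> \<and> gderR \<kappa> 1 = 1 \<and>
     0 < gderR \<kappa> 2 \<and> gderR \<kappa> 2 < \<infinity>"

definition hyp_Crit2 :: "(nat \<Rightarrow> real) \<Rightarrow> (nat \<Rightarrow> real) \<Rightarrow> bool" where
  "hyp_Crit2 \<theta> \<kappa> \<longleftrightarrow> (\<exists>R \<eta> \<phi> G\<theta> G\<kappa> \<theta>s \<delta> c0 c2.
     R > 0 \<and> radius \<theta> = ereal R \<and> radius \<kappa> = ereal R \<and> \<eta> > 0 \<and> 0 < \<phi> \<and> \<phi> < pi/2 \<and>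
     hol_cont \<theta> R (Delta0 R \<eta> \<phi>) G\<theta> \<and> hol_cont \<kappa> R (Delta0 R \<eta> \<phi>) G\<kappa> \<and>
     gderR \<kappa> 1 = 1 \<and> gderR \<kappa> 2 = ereal c2 \<and> 0 < c2 \<and> gderR \<kappa> 0 = ereal c0 \<and>
     \<theta>s \<ge> 0 \<and> \<delta> > 0 \<and>
     (\<lambda>z. G\<theta> z - (- of_real \<theta>s * Ln (u R z)))
        \<in> O[at (of_real R) within Delta0 R \<eta> \<phi>](\<lambda>z. u R z powr of_real \<delta>) \<and>
     (\<lambda>z. G\<kappa> z - (of_real c0 - u R z + of_real (c2 / 2) * u R z ^ 2))
        \<in> O[at (of_real R) within Delta0 R \<eta> \<phi>](\<lambda>z. u R z powr of_real (2 + \<delta>)))"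

definition hyp_Crit3 :: "(nat \<Rightarrow> real) \<Rightarrow> (nat \<Rightarrow> real) \<Rightarrow> bool" where
  "hyp_Crit3 \<theta> \<kappa> \<longleftrightarrow> (\<exists>R \<eta> \<phi> G\<theta> G\<kappa> \<theta>s \<delta> c0 s a_s.
     R > 0 \<and> radius \<theta> = ereal R \<and> radius \<kappa> = ereal R \<and> \<eta> > 0 \<and> 0 < \<phi> \<and> \<phi> < pi/2 \<and>
     hol_cont \<theta> R (Delta0 R \<eta> \<phi>) G\<theta> \<and> hol_cont \<kappa> R (Delta0 R \<eta> \<phi>) G\<kappa> \<and>
     gderR \<kappa> 1 = 1 \<and> gderR \<kappa> 0 = ereal c0 \<and>
     \<theta>s \<ge> 0 \<and> \<delta> > 0 \<and> 1 < s \<and> s < 2 \<and> a_s > 0 \<and>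
     (\<lambda>z. G\<theta> z - (- of_real \<theta>s * Ln (u R z)))
        \<in> O[at (of_real R) within Delta0 R \<eta> \<phi>](\<lambda>z. u R z powr of_real \<delta>) \<and>
     (\<lambda>z. G\<kappa> z - (of_real c0 - u R z + of_real a_s * u R z powr of_real s))
        \<in> O[at (of_real R) within Delta0 R \<eta> \<phi>](\<lambda>z. u R z powr of_real (s + \<delta>)))"

definition r_star :: "(nat \<Rightarrow> real) \<Rightarrow> real" where
  "r_star \<kappa> = (if gderR \<kappa> 1 \<ge> 1
      then (THE r. 0 < r \<and> ereal r \<le> radius \<kappa> \<and> gder_ext \<kappa> 1 r = 1)
      else real_of_ereal (radius \<kappa>))"

definition nu_tilde :: "(nat \<Rightarrow> real) \<Rightarrow> (nat \<Rightarrow> real) \<Rightarrow> nat \<Rightarrow> ereal" where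
  "nu_tilde \<theta> \<kappa> K = liminf (\<lambda>N. ereal (tail_mass \<theta> \<kappa> K N))"

end

theory Submission
  imports Defs "HOL-Computational_Algebra.Formal_Power_Series"
begin

text \<open>
  The argument is a soft large deviation estimate and needs neither contour integrals nor the
  expansions at the singularity. By Jensen's inequality, tilting the weight of the \<open>j\<close>-cycles by
  \<open>exp t\<close> bounds \<open>t * E_N C_j\<close> by the logarithm of a quotient of partition functions, whose numerator
  is controlled by the Chernoff bound \<open>[z^N] f(z) \<le> f(r) / r^N\<close> with \<open>r < r_*\<close>. With small \<open>t\<close> of
  both signs, \<open>E_N C_j / N\<close> tends to \<open>\<kappa> j * r_*^j / j\<close> as soon as \<open>liminf (ln H_N) / N\<close> is
  at least \<open>g_\<kappa>(r_*) - ln r_*\<close>. This lower bound is attained by one cycle type with bounded cycle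
  lengths: \<open>N * \<kappa> j * r^j / j\<close> cycles of each length \<open>j \<le> M\<close>, where \<open>r\<close> slightly above \<open>r_*\<close>
  solves \<open>\<Sum>j\<le>M. \<kappa> j * r^j = 1\<close>. In the supercritical case such an \<open>r\<close> exists because
  the partial sums are unbounded beyond the radius of convergence.
\<close>

subsection \<open>The partition function as a power series coefficient\<close>

unbundle no vec_syntax
unbundle fps_syntax

text \<open>Defined on an arbitrary finite set rather than on \<open>{1..N}\<close>, because the
  induction in \<open>sum_cycle_weight\<close> deletes arbitrary points.\<close>

definition cycle_weight :: "(nat \<Rightarrow> real) \<Rightarrow> 'a set \<Rightarrow> ('a \<Rightarrow> 'a) \<Rightarrow> real" where
  "cycle_weight w A \<sigma> = (\<Prod>c\<in>orbit \<sigma> ` A. w (card c))"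

text \<open>The cycle of \<open>b\<close> is weighted as if it had \<open>k\<close> further elements, so that deleting an element
  from its cycle (see \<open>sum_cycle_weight_at_insert\<close>) turns into the shift from \<open>k\<close> to \<open>Suc k\<close>.\<close>

definition cycle_weight_at :: "(nat \<Rightarrow> real) \<Rightarrow> nat \<Rightarrow> 'a set \<Rightarrow> 'a \<Rightarrow> ('a \<Rightarrow> 'a) \<Rightarrow> real" where
  "cycle_weight_at w k A b \<sigma> =
     w (card (orbit \<sigma> b) + k) * (\<Prod>c\<in>orbit \<sigma> ` A - {orbit \<sigma> b}. w (card c))"

lemma cycle_weight_at_0:
  assumes "finite A" "b \<in> A"
  shows "cycle_weight_at w 0 A b \<sigma> = cycle_weight w A \<sigma>"
  unfolding cycle_weight_at_def cycle_weight_def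
  using assms by (simp add: prod.remove[of "orbit \<sigma> ` A" "orbit \<sigma> b"])

lemma orbit_eq_of_mem:
  assumes "permutation f" "y \<in> orbit f x"
  shows "orbit f y = orbit f x"
  using cyclic_on_orbit'[OF assms(1), of x] assms(2) unfolding cyclic_on_alldef by auto

lemma permutes_permutation: "finite A \<Longrightarrow> \<sigma> permutes A \<Longrightarrow> permutation \<sigma>"
  by (auto simp: permutation_permutes)

text \<open>\<open>\<sigma>\<close> is \<open>\<tau>\<close> with \<open>x\<close> spliced into the
  cycle of \<open>b\<close>, directly in front of \<open>b\<close>: the preimage of \<open>b\<close>
  now goes to \<open>x\<close>, and \<open>x\<close> goes to \<open>b\<close>. Every permutation of
  \<open>insert x A\<close> that moves \<open>x\<close> arises in this way from exactly one pair of
  \<open>b\<close> and \<open>\<tau>\<close>.\<close>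

context
  fixes A :: "'a set" and \<tau> :: "'a \<Rightarrow> 'a" and x b :: 'a and \<sigma> :: "'a \<Rightarrow> 'a"
  assumes A: "finite A" "\<tau> permutes A" "x \<notin> A" "b \<in> A"
  defines "\<sigma> \<equiv> Transposition.transpose x b \<circ> \<tau>"
begin

lemma insert_in_cycle_permutes: "\<sigma> permutes insert x A"
  unfolding \<sigma>_def using A
  by (intro permutes_compose permutes_swap_id) (auto intro: permutes_subset)

lemma orbit_insert_in_cycle: "orbit \<sigma> x = insert x (orbit \<tau> b)"
proof -
  have \<tau>x: "\<tau> x = x" using A by (simp add: permutes_not_in)
  have \<sigma>x: "\<sigma> x = b" by (simp add: \<sigma>_def \<tau>x)
  have perm\<tau>: "permutation \<tau>" using A by (intro permutes_permutation)
  have perm\<sigma>: "permutation \<sigma>"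
    using insert_in_cycle_permutes A by (intro permutes_permutation[of "insert x A"]) auto
  have bb: "b \<in> orbit \<tau> b" by (rule permutation_self_in_orbit[OF perm\<tau>])
  have sub: "orbit \<tau> b \<subseteq> A" using A by (intro permutes_orbit_subset)
  have x1: "x \<in> orbit \<sigma> x" and b1: "b \<in> orbit \<sigma> x"
    using permutation_self_in_orbit[OF perm\<sigma>] orbit.base[of \<sigma> x] by (auto simp: \<sigma>x)
  show ?thesis
  proof (intro equalityI subsetI)
    fix y assume "y \<in> orbit \<sigma> x"
    then show "y \<in> insert x (orbit \<tau> b)"
    proof induct
      case base show ?case using bb by (simp add: \<sigma>x)
    next
      case (step z)
      show ?case
      proof (cases "z = x")
        case True then show ?thesis using bb by (simp add: \<sigma>x)
      next
        case False
        then have "\<tau> z \<in> orbit \<tau> b" using step by (auto intro: orbit.step)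
        then show ?thesis using sub A by (auto simp: \<sigma>_def Transposition.transpose_def)
      qed
    qed
  next
    fix y assume "y \<in> insert x (orbit \<tau> b)"
    then show "y \<in> orbit \<sigma> x"
    proof
      assume "y = x" then show ?thesis using x1 by simp
    next
      \<comment> \<open>\<open>\<sigma>\<close> and \<open>\<tau>\<close> differ at \<open>z\<close>
        only if \<open>\<tau> z\<close> is \<open>b\<close> or \<open>x\<close>; the value
        \<open>x\<close> is excluded, and \<open>b\<close> itself lies on the cycle of
        \<open>x\<close>.\<close>
      have *: "\<tau> z \<in> orbit \<sigma> x" if "z \<in> orbit \<sigma> x" "\<tau> z \<noteq> x" for z
      proof (cases "\<tau> z = b")
        case True then show ?thesis using b1 by simp
      next
        case False
        then have "\<sigma> z = \<tau> z" using that by (simp add: \<sigma>_def Transposition.transpose_def)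
        then show ?thesis using orbit.step[OF that(1)] by simp
      qed
      assume "y \<in> orbit \<tau> b"
      \<comment> \<open>Membership in \<open>A\<close> is carried along because it gives
        \<open>\<tau> y \<noteq> x\<close>, the premise of \<open>*\<close>.\<close>
      then have "y \<in> orbit \<sigma> x \<and> y \<in> A"
      proof induct
        case base show ?case using *[OF b1] A by (metis permutes_in_image)
      next
        case (step y) then show ?case using *[of y] A by (metis permutes_in_image)
      qed
      then show ?thesis by simp
    qed
  qed
qed

lemma orbit_insert_other_cycle:
  assumes "y \<in> A" "y \<notin> orbit \<tau> b"
  shows "orbit \<sigma> y = orbit \<tau> y"
proof (rule orbit_cong)
  have perm\<tau>: "permutation \<tau>" using A by (intro permutes_permutation)
  show "y \<in> orbit \<tau> y" by (rule permutation_self_in_orbit[OF perm\<tau>])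
  fix s assume s: "s \<in> orbit \<tau> y"
  then have "\<tau> s \<in> orbit \<tau> y" by (rule orbit.step)
  moreover have "\<tau> s \<in> A" using permutes_orbit_subset[OF A(2) assms(1)] calculation by auto
  moreover have "b \<notin> orbit \<tau> y"
    using orbit_eq_of_mem[OF perm\<tau>, of b y] permutation_self_in_orbit[OF perm\<tau>, of y] assms by auto
  ultimately have "\<tau> s \<noteq> b" "\<tau> s \<noteq> x" using A by auto
  then show "\<sigma> s = \<tau> s" by (simp add: \<sigma>_def)
qed

text \<open>The splice lengthens the cycle of \<open>b\<close> by one and leaves all other cycles
  alone; the extra element is booked in \<open>Suc k\<close>.\<close>

lemma cycle_weight_at_insert:
  "cycle_weight_at w k (insert x A) x \<sigma> = cycle_weight_at w (Suc k) A b \<tau>"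
proof -
  have perm\<tau>: "permutation \<tau>" using A by (intro permutes_permutation)
  have perm\<sigma>: "permutation \<sigma>"
    using insert_in_cycle_permutes A by (intro permutes_permutation[of "insert x A"]) auto
  have sub: "orbit \<tau> b \<subseteq> A" using A by (intro permutes_orbit_subset)
  have card: "card (orbit \<sigma> x) = Suc (card (orbit \<tau> b))"
  proof -
    have "finite (orbit \<tau> b)" "x \<notin> orbit \<tau> b"
      using sub A(1,3) finite_subset by blast+
    then show ?thesis by (simp add: orbit_insert_in_cycle)
  qed
  have "orbit \<sigma> ` insert x A - {orbit \<sigma> x} = orbit \<sigma> ` (A - orbit \<tau> b)"
  proof -
    have "orbit \<sigma> y = orbit \<sigma> x" if "y \<in> orbit \<tau> b" for y
      using that by (intro orbit_eq_of_mem[OF perm\<sigma>]) (simp add: orbit_insert_in_cycle)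
    moreover have "orbit \<sigma> y \<noteq> orbit \<sigma> x" if "y \<in> A" "y \<notin> orbit \<tau> b" for y
    proof
      assume "orbit \<sigma> y = orbit \<sigma> x"
      then have "y \<in> insert x (orbit \<tau> b)"
        using permutation_self_in_orbit[OF perm\<sigma>, of y] by (simp only: orbit_insert_in_cycle)
      then show False using that A(3) by blast
    qed
    ultimately have "orbit \<sigma> y = orbit \<sigma> x \<longleftrightarrow> y \<in> orbit \<tau> b" if "y \<in> A" for y
      using that by metis
    then show ?thesis by (simp add: image_insert) (auto simp: image_iff)
  qed
  also have "\<dots> = orbit \<tau> ` (A - orbit \<tau> b)"
    by (intro image_cong refl orbit_insert_other_cycle) auto
  also have "\<dots> = orbit \<tau> ` A - {orbit \<tau> b}"
  proof -
    have "orbit \<tau> y = orbit \<tau> b" if "y \<in> orbit \<tau> b" for y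
      using that by (intro orbit_eq_of_mem[OF perm\<tau>])
    moreover have "orbit \<tau> y \<noteq> orbit \<tau> b" if "y \<notin> orbit \<tau> b" for y
      using permutation_self_in_orbit[OF perm\<tau>, of y] that by metis
    ultimately have "orbit \<tau> y = orbit \<tau> b \<longleftrightarrow> y \<in> orbit \<tau> b" for y
      by metis
    then show ?thesis by (auto simp: image_iff)
  qed
  finally show ?thesis by (simp only: cycle_weight_at_def card add_Suc add_Suc_right)
qed

end

lemma cycle_weight_at_fixpoint:
  assumes "finite A" "\<tau> permutes A" "x \<notin> A"
  shows "cycle_weight_at w k (insert x A) x \<tau> = w (Suc k) * cycle_weight w A \<tau>"
proof -
  have 1: "orbit \<tau> x = {x}" using assms by (simp add: orbit_eq_singleton_iff permutes_not_in)
  have "orbit \<tau> y \<noteq> {x}" if "y \<in> A" for y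
    using permutes_orbit_subset[OF assms(2) that] assms(3) by auto
  then have "orbit \<tau> ` insert x A - {orbit \<tau> x} = orbit \<tau> ` A" using 1 by auto
  then show ?thesis unfolding cycle_weight_at_def cycle_weight_def by (simp add: 1)
qed

text \<open>Split by the image of \<open>x\<close>: the first term collects the permutations fixing
  \<open>x\<close>, the summand of \<open>b\<close> those sending \<open>x\<close> to
  \<open>b\<close>.\<close>

lemma sum_cycle_weight_at_insert:
  assumes "finite A" "x \<notin> A"
  shows "(\<Sum>\<sigma> | \<sigma> permutes insert x A. cycle_weight_at w k (insert x A) x \<sigma>) =
    w (Suc k) * (\<Sum>\<tau> | \<tau> permutes A. cycle_weight w A \<tau>) +
    (\<Sum>b\<in>A. \<Sum>\<tau> | \<tau> permutes A. cycle_weight_at w (Suc k) A b \<tau>)"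
  using assms
  by (simp add: sum_over_permutations_insert cycle_weight_at_fixpoint sum_distrib_left
      cycle_weight_at_insert)

text \<open>For \<open>k = 0\<close> the second claim sorts permutations by the length
  \<open>Suc i\<close> of the cycle of \<open>b\<close>, which by the recursion for \<open>h\<close>
  yields the first. General \<open>k\<close> is needed since each deletion of a point raises
  \<open>k\<close> by one.\<close>

lemma sum_cycle_weight:
  fixes w h :: "nat \<Rightarrow> real" and A :: "'a set"
  assumes h0: "h 0 = 1"
    and h: "\<And>n. 1 \<le> n \<Longrightarrow> n \<le> N \<Longrightarrow> real n * h n = (\<Sum>i<n. w (Suc i) * h (n - Suc i))"
  shows "finite A \<Longrightarrow> card A \<le> N \<Longrightarrow>
     (\<Sum>\<sigma> | \<sigma> permutes A. cycle_weight w A \<sigma>) = fact (card A) * h (card A) \<and>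
     (\<forall>k. \<forall>b\<in>A. (\<Sum>\<sigma> | \<sigma> permutes A. cycle_weight_at w k A b \<sigma>) =
        fact (card A - 1) * (\<Sum>i<card A. w (Suc i + k) * h (card A - Suc i)))"
proof (induction "card A" arbitrary: A)
  case 0
  then show ?case by (simp add: cycle_weight_def h0)
next
  case (Suc n)
  have at: "(\<Sum>\<sigma> | \<sigma> permutes A. cycle_weight_at w k A x \<sigma>) =
        fact n * (\<Sum>i<Suc n. w (Suc i + k) * h (n - i))" if "x \<in> A" for k x
  proof -
    define B where "B = A - {x}"
    have A: "A = insert x B" and xB: "x \<notin> B" using that by (auto simp: B_def)
    have B: "finite B" "card B = n" using that Suc.prems Suc.hyps(2) by (simp_all add: B_def)
    have "n \<le> N" using Suc.prems Suc.hyps(2) by simp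
    note IH' = Suc.hyps(1)[OF B(2)[symmetric] B(1), unfolded B(2), OF this]
    have IH: "(\<Sum>\<sigma> | \<sigma> permutes B. cycle_weight w B \<sigma>) = fact n * h n"
      "\<And>k b. b \<in> B \<Longrightarrow> (\<Sum>\<sigma> | \<sigma> permutes B. cycle_weight_at w k B b \<sigma>) =
        fact (n - 1) * (\<Sum>i<n. w (Suc i + k) * h (n - Suc i))"
      using IH' by blast+
    have "(\<Sum>\<sigma> | \<sigma> permutes A. cycle_weight_at w k A x \<sigma>) =
       w (Suc k) * (fact n * h n) +
       real n * (fact (n - 1) * (\<Sum>i<n. w (Suc i + Suc k) * h (n - Suc i)))"
      unfolding A sum_cycle_weight_at_insert[OF B(1) xB] IH(1) by (simp add: IH(2) B(2) del: add_Suc_right add_Suc)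
    \<comment> \<open>For \<open>n = 0\<close> the sum is empty, so the truncated
      \<open>n - 1\<close> does no harm.\<close>
    also have "real n * (fact (n - 1) * (\<Sum>i<n. w (Suc i + Suc k) * h (n - Suc i))) =
      fact n * (\<Sum>i<n. w (Suc i + Suc k) * h (n - Suc i))"
      by (cases n) auto
    \<comment> \<open>The fixed-point term is the summand \<open>i = 0\<close> of the shifted
      sum.\<close>
    finally show ?thesis
      by (simp add: sum.lessThan_Suc_shift distrib_left del: sum.lessThan_Suc)
  qed
  have "A \<noteq> {}" using Suc by auto
  then obtain x where x: "x \<in> A" by auto
  have "(\<Sum>\<sigma> | \<sigma> permutes A. cycle_weight w A \<sigma>) =
        (\<Sum>\<sigma> | \<sigma> permutes A. cycle_weight_at w 0 A x \<sigma>)"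
    using x Suc by (simp add: cycle_weight_at_0)
  also have "\<dots> = fact n * (real (Suc n) * h (Suc n))"
  proof -
    have "Suc n \<le> N" using Suc.prems Suc.hyps(2) by simp
    then show ?thesis unfolding at[OF x] by (subst h) simp_all
  qed
  also have "\<dots> = fact (Suc n) * h (Suc n)" by simp
  finally show ?case using at unfolding Suc.hyps(2)[symmetric] by simp
qed

section \<open>The exponential series exp(a X^j / j) of the cycles of length j\<close>

definition cycle_fps :: "real \<Rightarrow> nat \<Rightarrow> real fps" where
  "cycle_fps a j = Abs_fps (\<lambda>n. if j dvd n then (a / real j) ^ (n div j) / fact (n div j) else 0)"

lemma cycle_fps_nth_mult: "0 < j \<Longrightarrow> cycle_fps a j $ (j * m) = (a / real j) ^ m / fact m"
  by (simp add: cycle_fps_def)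

lemma cycle_fps_nonneg: "0 \<le> a \<Longrightarrow> 0 \<le> cycle_fps a j $ n"
  by (simp add: cycle_fps_def)

text \<open>The chain rule for exp(a X^j / j), checked coefficient by coefficient.\<close>

lemma fps_deriv_cycle_fps:
  assumes "0 < j"
  shows "fps_deriv (cycle_fps a j) = fps_const a * fps_X ^ (j - 1) * cycle_fps a j"
proof (rule fps_ext)
  fix n
  have *: "real (Suc n) * cycle_fps a j $ Suc n = (if n < j - 1 then 0 else a * cycle_fps a j $ (Suc n - j))"
  proof (cases "j dvd Suc n")
    case True
    then obtain m where m: "Suc n = j * m" by blast
    then obtain l where l: "m = Suc l" by (cases m) auto
    have "j \<le> Suc n" using True by (rule dvd_imp_le) simp
    then have "\<not> n < j - 1" by linarith
    moreover have "Suc n - j = j * l" using m l by simp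
    moreover have "real (Suc n) = real j * real m" using m by (metis of_nat_mult)
    moreover have "real j * real m * ((a / real j) ^ m / fact m) = a * ((a / real j) ^ l / fact l)"
      using assms unfolding l by (simp add: field_simps del: of_nat_Suc)
    ultimately show ?thesis
      using cycle_fps_nth_mult[OF assms, of a m] cycle_fps_nth_mult[OF assms, of a l] m by simp
  next
    case False
    then have "\<not> n < j - 1 \<Longrightarrow> \<not> j dvd (Suc n - j)"
      using assms by (auto simp: dvd_minus_self)
    then show ?thesis using False by (simp add: cycle_fps_def)
  qed
  have "(fps_const a * fps_X ^ (j - 1) * cycle_fps a j) $ n = (if n < j - 1 then 0 else a * cycle_fps a j $ (Suc n - j))"
    using assms by (simp add: mult.assoc fps_X_power_mult_nth Suc_diff_le) 
  then show "fps_deriv (cycle_fps a j) $ n = (fps_const a * fps_X ^ (j - 1) * cycle_fps a j) $ n"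
    using * by simp
qed

lemma fps_deriv_prod_cycle_fps:
  assumes "finite J" "0 \<notin> J"
  shows "fps_deriv (\<Prod>j\<in>J. cycle_fps (w j) j) =
    (\<Sum>j\<in>J. fps_const (w j) * fps_X ^ (j - 1)) * (\<Prod>j\<in>J. cycle_fps (w j) j)"
  using assms by (induction) (auto simp: fps_deriv_cycle_fps algebra_simps)

text \<open>Compare the coefficients of X^(n-1) in F' = (\<Sum> w_j X^(j-1)) F. The bound
  \<open>n \<le> N\<close> ensures that every length up to \<open>n\<close> occurs in the
  product.\<close>

lemma prod_cycle_fps_recursion:
  fixes w :: "nat \<Rightarrow> real"
  assumes "1 \<le> n" "n \<le> N"
  defines "F \<equiv> (\<Prod>j=1..N. cycle_fps (w j) j)"
  shows "real n * F $ n = (\<Sum>i<n. w (Suc i) * F $ (n - Suc i))"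
proof -
  have "real n * F $ n = fps_deriv F $ (n - 1)" using assms by simp
  also have "fps_deriv F = (\<Sum>j=1..N. fps_const (w j) * fps_X ^ (j - 1)) * F"
    unfolding F_def by (rule fps_deriv_prod_cycle_fps) auto
  also have "\<dots> $ (n - 1) = (\<Sum>j=1..N. if n - 1 < j - 1 then 0 else w j * F $ (n - 1 - (j - 1)))"
    unfolding sum_distrib_right fps_sum_nth
    by (intro sum.cong refl) (simp add: mult.assoc fps_X_power_mult_nth)
  also have "\<dots> = (\<Sum>i<N. if n \<le> i then 0 else w (Suc i) * F $ (n - Suc i))"
    by (rule sum.reindex_bij_witness[of _ Suc "\<lambda>j. j - 1"]) (use assms in auto)
  also have "\<dots> = (\<Sum>i<n. w (Suc i) * F $ (n - Suc i))"
    using assms by (intro sum.mono_neutral_cong_right) auto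
  finally show ?thesis .
qed

lemma prod_cycle_fps_nth_0: "(\<Prod>j\<in>J. cycle_fps (w j) j) $ 0 = 1"
  by (induction J rule: infinite_finite_induct) (auto simp: cycle_fps_def)

section \<open>Permutation weights in terms of cycle counts\<close>

definition gen_weight :: "(nat \<Rightarrow> real) \<Rightarrow> nat \<Rightarrow> (nat \<Rightarrow> nat) \<Rightarrow> real" where
  "gen_weight w N \<sigma> = (\<Prod>j=1..N. w j ^ cyc_count N \<sigma> j)"

text \<open>This is \<open>H_N\<close> for arbitrary weights, so that a single weight can be
  tilted.\<close>

definition partition_fun :: "(nat \<Rightarrow> real) \<Rightarrow> nat \<Rightarrow> real" where
  "partition_fun w N = (\<Sum>\<sigma>\<in>perms N. gen_weight w N \<sigma>) / fact N"

lemma cyc_count_altdef: "cyc_count N \<sigma> j = card {c \<in> orbit \<sigma> ` {1..N}. card c = j}"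
  unfolding cyc_count_def by (rule arg_cong[of _ _ card]) auto

lemma card_orbit_in:
  assumes "\<sigma> permutes {1..N}" "c \<in> orbit \<sigma> ` {1..N}"
  shows "card c \<in> {1..N}"
proof -
  obtain x where x: "x \<in> {1..N}" "c = orbit \<sigma> x" using assms by auto
  have "c \<subseteq> {1..N}" using x permutes_orbit_subset[OF assms(1)] by simp
  moreover have "c \<noteq> {}" using x orbit_nonempty[of \<sigma> x] by simp
  ultimately show ?thesis
    using card_mono[of "{1..N}" c] finite_subset[of c "{1..N}"] by (auto simp: Suc_le_eq card_gt_0_iff)
qed

lemma gen_weight_eq_cycle_weight:
  assumes "\<sigma> permutes {1..N}"
  shows "gen_weight w N \<sigma> = cycle_weight w {1..N} \<sigma>"
proof -
  have "cycle_weight w {1..N} \<sigma> =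
    (\<Prod>j=1..N. \<Prod>c\<in>{c \<in> orbit \<sigma> ` {1..N}. card c = j}. w (card c))"
    unfolding cycle_weight_def
    by (rule prod.group[symmetric]) (use card_orbit_in[OF assms] in auto)
  also have "\<dots> = gen_weight w N \<sigma>"
    unfolding gen_weight_def cyc_count_altdef by (intro prod.cong refl) simp
  finally show ?thesis by simp
qed

text \<open>The orbits partition \<open>{1..N}\<close>, so their cardinalities add up.\<close>

lemma sum_cycle_lengths:
  assumes "\<sigma> permutes {1..N}"
  shows "(\<Sum>j=1..N. real j * real (cyc_count N \<sigma> j)) = real N"
proof -
  have perm: "permutation \<sigma>" using assms by (intro permutes_permutation[of "{1..N}"]) auto
  have "(\<Sum>j=1..N. real j * real (cyc_count N \<sigma> j)) =
    (\<Sum>j=1..N. \<Sum>c\<in>{c \<in> orbit \<sigma> ` {1..N}. card c = j}. real (card c))"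
    unfolding cyc_count_altdef by (intro sum.cong refl) simp
  also have "\<dots> = (\<Sum>c\<in>orbit \<sigma> ` {1..N}. real (card c))"
    by (rule sum.group) (use card_orbit_in[OF assms] in auto)
  also have "\<dots> = real (\<Sum>c\<in>orbit \<sigma> ` {1..N}. card c)" by simp
  also have "(\<Sum>c\<in>orbit \<sigma> ` {1..N}. card c) = card (\<Union>(orbit \<sigma> ` {1..N}))"
  proof (rule card_Union_disjoint[symmetric])
    show "pairwise disjnt (orbit \<sigma> ` {1..N})"
      unfolding pairwise_def disjnt_iff using orbit_eq_of_mem[OF perm] by blast
    show "\<And>c. c \<in> orbit \<sigma> ` {1..N} \<Longrightarrow> finite c"
      using permutes_orbit_subset[OF assms] finite_subset by blast
  qed
  also have "\<Union>(orbit \<sigma> ` {1..N}) = {1..N}"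
    using permutes_orbit_subset[OF assms] permutation_self_in_orbit[OF perm] by blast
  finally show ?thesis by simp
qed

text \<open>The exponential formula for permutations: the coefficients of the product obey the
  recursion that determines the sum over permutations.\<close>

theorem partition_fun_eq_fps_nth:
  "partition_fun w N = (\<Prod>j=1..N. cycle_fps (w j) j) $ N"
proof -
  define h where "h = fps_nth (\<Prod>j=1..N. cycle_fps (w j) j)"
  have h0: "h 0 = 1" unfolding h_def by (rule prod_cycle_fps_nth_0)
  have h: "real n * h n = (\<Sum>i<n. w (Suc i) * h (n - Suc i))" if "1 \<le> n" "n \<le> N" for n
    unfolding h_def using that by (rule prod_cycle_fps_recursion)
  have "(\<Sum>\<sigma>\<in>perms N. gen_weight w N \<sigma>) = (\<Sum>\<sigma> | \<sigma> permutes {1..N}. cycle_weight w {1..N} \<sigma>)"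
    unfolding perms_def by (intro sum.cong refl gen_weight_eq_cycle_weight) simp
  also have "\<dots> = fact (card {1..N}) * h (card {1..N})"
    using sum_cycle_weight[of h N w "{1..N}", OF h0 h] by (simp only: finite_atLeastAtMost card_atLeastAtMost)
  finally show ?thesis unfolding partition_fun_def h_def by simp
qed

subsection \<open>Bounds for the partition function\<close>

lemma fps_mult_nonneg:
  fixes f g :: "real fps"
  assumes "\<And>n. 0 \<le> f $ n" "\<And>n. 0 \<le> g $ n"
  shows "0 \<le> (f * g) $ n"
  unfolding fps_mult_nth using assms by (intro sum_nonneg mult_nonneg_nonneg)

lemma fps_prod_nonneg:
  fixes f :: "'a \<Rightarrow> real fps"
  assumes "\<And>j n. j \<in> J \<Longrightarrow> 0 \<le> f j $ n"
  shows "0 \<le> (\<Prod>j\<in>J. f j) $ n"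
  using assms
  by (induction J arbitrary: n rule: infinite_finite_induct) (auto intro: fps_mult_nonneg)

lemma fps_prod_nth_ge:
  fixes f :: "'a \<Rightarrow> real fps"
  assumes "finite J" "\<And>j n. j \<in> J \<Longrightarrow> 0 \<le> f j $ n"
  shows "(\<Prod>j\<in>J. f j $ a j) \<le> (\<Prod>j\<in>J. f j) $ (\<Sum>j\<in>J. a j)"
  using assms
proof (induction J)
  case empty
  then show ?case by simp
next
  case (insert x J)
  let ?P = "\<Prod>j\<in>J. f j" and ?s = "\<Sum>j\<in>J. a j"
  have "f x $ a x * (\<Prod>j\<in>J. f j $ a j) \<le> f x $ a x * ?P $ ?s"
    using insert by (intro mult_left_mono) auto
  also have "\<dots> = (\<lambda>i. f x $ i * ?P $ (a x + ?s - i)) (a x)" by simp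
  also have "\<dots> \<le> (\<Sum>i=0..a x + ?s. f x $ i * ?P $ (a x + ?s - i))"
    using insert.prems by (intro member_le_sum mult_nonneg_nonneg fps_prod_nonneg) auto
  finally show ?case using insert by (simp add: fps_mult_nth)
qed

lemma fps_sums_mult:
  fixes f g :: "real fps"
  assumes "\<And>n. 0 \<le> f $ n" "\<And>n. 0 \<le> g $ n" "0 \<le> r"
    and "(\<lambda>n. f $ n * r ^ n) sums a" "(\<lambda>n. g $ n * r ^ n) sums b"
  shows "(\<lambda>n. (f * g) $ n * r ^ n) sums (a * b)"
proof -
  have "(\<lambda>k. \<Sum>i\<le>k. (f $ i * r ^ i) * (g $ (k - i) * r ^ (k - i))) sums
      ((\<Sum>k. f $ k * r ^ k) * (\<Sum>k. g $ k * r ^ k))"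
    using assms by (intro Cauchy_product_sums) (auto simp: sums_iff abs_mult)
  also have "(\<lambda>k. \<Sum>i\<le>k. (f $ i * r ^ i) * (g $ (k - i) * r ^ (k - i))) = (\<lambda>n. (f * g) $ n * r ^ n)"
    unfolding fps_mult_nth sum_distrib_right
    by (intro ext sum.cong) (auto simp: power_add[symmetric] mult_ac)
  finally show ?thesis using assms by (simp add: sums_iff)
qed

text \<open>Only multiples of \<open>j\<close> contribute; reindexing by them leaves the exponential
  series.\<close>

lemma cycle_fps_sums:
  assumes "0 < j"
  shows "(\<lambda>n. cycle_fps a j $ n * r ^ n) sums exp (a * r ^ j / real j)"
proof -
  have "(\<lambda>n. cycle_fps a j $ n * r ^ n) sums exp (a * r ^ j / real j) \<longleftrightarrow>
    (\<lambda>n. cycle_fps a j $ (j * n) * r ^ (j * n)) sums exp (a * r ^ j / real j)"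
    by (rule sums_mono_reindex[symmetric])
       (use assms in \<open>auto simp: strict_mono_def cycle_fps_def elim!: dvdE\<close>)
  also have "(\<lambda>n. cycle_fps a j $ (j * n) * r ^ (j * n)) =
      (\<lambda>n. (a * r ^ j / real j) ^ n /\<^sub>R fact n)"
    unfolding cycle_fps_nth_mult[OF assms] power_mult
    by (simp add: power_mult_distrib power_divide field_simps)
  also have "\<dots> sums exp (a * r ^ j / real j)" by (rule exp_converges)
  finally show ?thesis by simp
qed

lemma prod_cycle_fps_sums:
  assumes "finite J" "0 \<notin> J" "\<And>j. j \<in> J \<Longrightarrow> 0 \<le> w j" "0 \<le> r"
  shows "(\<lambda>n. (\<Prod>j\<in>J. cycle_fps (w j) j) $ n * r ^ n) sums exp (\<Sum>j\<in>J. w j * r ^ j / real j)"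
  using assms
proof (induction J)
  case empty
  then show ?case using sums_finite[of "{0}" "\<lambda>n. (1::real fps) $ n * r ^ n"] by simp
next
  case (insert x J)
  then show ?case
    by (auto simp: exp_add intro!: fps_sums_mult cycle_fps_sums fps_prod_nonneg cycle_fps_nonneg)
qed

text \<open>All terms of the generating function at \<open>r\<close> are nonnegative, so the
  \<open>N\<close>-th one alone is at most its value.\<close>

lemma partition_fun_upper:
  assumes "\<And>j. j \<in> {1..N} \<Longrightarrow> 0 \<le> w j" "0 < r"
  shows "partition_fun w N \<le> exp (\<Sum>j=1..N. w j * r ^ j / real j) / r ^ N"
proof -
  let ?F = "\<Prod>j=1..N. cycle_fps (w j) j"
  have s: "(\<lambda>n. ?F $ n * r ^ n) sums exp (\<Sum>j=1..N. w j * r ^ j / real j)"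
    using assms by (intro prod_cycle_fps_sums) auto
  have "(\<Sum>n\<in>{N}. ?F $ n * r ^ n) \<le> (\<Sum>n. ?F $ n * r ^ n)"
    using s assms by (intro sum_le_suminf) 
      (auto simp: sums_iff intro!: mult_nonneg_nonneg fps_prod_nonneg cycle_fps_nonneg)
  then have "?F $ N * r ^ N \<le> exp (\<Sum>j=1..N. w j * r ^ j / real j)"
    using s by (simp add: sums_iff)
  then show ?thesis using assms by (simp add: partition_fun_eq_fps_nth field_simps)
qed

text \<open>The left side is the share of the permutations with exactly \<open>a j\<close> cycles of
  each length \<open>j \<in> J\<close> and no others.\<close>

lemma partition_fun_lower:
  assumes "\<And>j. j \<in> {1..N} \<Longrightarrow> 0 \<le> w j" "J \<subseteq> {1..N}" "(\<Sum>j\<in>J. j * a j) = N"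
  shows "(\<Prod>j\<in>J. (w j / real j) ^ a j / fact (a j)) \<le> partition_fun w N"
proof -
  \<comment> \<open>Lengths outside \<open>J\<close> get count 0 and contribute a factor 1.\<close>
  define b where "b j = (if j \<in> J then a j else 0)" for j
  have N: "(\<Sum>j=1..N. j * b j) = N"
    using assms(3) sum.mono_neutral_left[of "{1..N}" J "\<lambda>j. j * b j"] assms(2)
    by (auto simp: b_def)
  have "(\<Prod>j\<in>J. (w j / real j) ^ a j / fact (a j)) = (\<Prod>j=1..N. (w j / real j) ^ b j / fact (b j))"
    using assms(2) by (intro prod.mono_neutral_cong_left) (auto simp: b_def)
  also have "\<dots> = (\<Prod>j=1..N. cycle_fps (w j) j $ (j * b j))"
    by (intro prod.cong refl) (simp add: cycle_fps_nth_mult)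
  also have "\<dots> \<le> (\<Prod>j=1..N. cycle_fps (w j) j) $ (\<Sum>j=1..N. j * b j)"
    using assms by (intro fps_prod_nth_ge cycle_fps_nonneg) auto
  finally show ?thesis by (simp only: N partition_fun_eq_fps_nth)
qed

section \<open>Mean cycle counts under exponential tilting\<close>

definition mean_count :: "(nat \<Rightarrow> real) \<Rightarrow> nat \<Rightarrow> nat \<Rightarrow> real" where
  "mean_count w N j = (\<Sum>\<sigma>\<in>perms N. gen_weight w N \<sigma> * real (cyc_count N \<sigma> j)) /
     (fact N * partition_fun w N)"

lemma gen_weight_tilt:
  assumes "j \<in> {1..N}"
  shows "gen_weight (w(j := exp t * w j)) N \<sigma> = exp (t * real (cyc_count N \<sigma> j)) * gen_weight w N \<sigma>"
proof -
  have "gen_weight (w(j := exp t * w j)) N \<sigma> =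
    (\<Prod>i=1..N. (if i = j then exp t ^ cyc_count N \<sigma> j else 1) * w i ^ cyc_count N \<sigma> i)"
    unfolding gen_weight_def by (intro prod.cong) (auto simp: power_mult_distrib)
  also have "\<dots> = exp t ^ cyc_count N \<sigma> j * gen_weight w N \<sigma>"
    unfolding gen_weight_def prod.distrib using assms by (subst prod.delta) simp_all
  finally show ?thesis by (simp add: exp_of_nat2_mult)
qed

text \<open>Jensen's inequality: the quotient of the two partition functions is the expectation of
  exp(t C_j).\<close>

lemma mean_count_le_tilt:
  assumes w: "\<And>j. j \<in> {1..N} \<Longrightarrow> 0 \<le> w j" and pos: "0 < partition_fun w N" and j: "j \<in> {1..N}"
  shows "exp (t * mean_count w N j) * partition_fun w N \<le> partition_fun (w(j := exp t * w j)) N"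
proof -
  define m where "m = mean_count w N j"
  have nonneg: "0 \<le> gen_weight w N \<sigma>" for \<sigma>
    unfolding gen_weight_def using w by (intro prod_nonneg) auto
  have Z: "(\<Sum>\<sigma>\<in>perms N. gen_weight w N \<sigma>) = fact N * partition_fun w N"
    by (simp add: partition_fun_def)
  have M: "(\<Sum>\<sigma>\<in>perms N. gen_weight w N \<sigma> * real (cyc_count N \<sigma> j)) = m * (fact N * partition_fun w N)"
    using pos by (simp add: m_def mean_count_def)
  \<comment> \<open>The tangent of exp(t c) at the mean \<open>c = m\<close>; its linear term
    vanishes on averaging.\<close>
  have "exp (t * m) * (1 + t * (c - m)) \<le> exp (t * c)" for c
  proof -
    have "exp (t * m) * (1 + t * (c - m)) \<le> exp (t * m) * exp (t * (c - m))"
      by (intro mult_left_mono exp_ge_add_one_self) auto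
    also have "\<dots> = exp (t * c)" by (simp add: exp_add[symmetric] algebra_simps)
    finally show ?thesis .
  qed
  then have "(\<Sum>\<sigma>\<in>perms N. exp (t * m) * (1 + t * (real (cyc_count N \<sigma> j) - m)) * gen_weight w N \<sigma>)
    \<le> (\<Sum>\<sigma>\<in>perms N. exp (t * real (cyc_count N \<sigma> j)) * gen_weight w N \<sigma>)"
    using nonneg by (intro sum_mono mult_right_mono)
  also have "\<dots> = fact N * partition_fun (w(j := exp t * w j)) N"
    using j by (simp add: partition_fun_def gen_weight_tilt)
  also have "(\<Sum>\<sigma>\<in>perms N. exp (t * m) * (1 + t * (real (cyc_count N \<sigma> j) - m)) * gen_weight w N \<sigma>)
    = exp (t * m) * ((1 - t * m) * (\<Sum>\<sigma>\<in>perms N. gen_weight w N \<sigma>) +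
        t * (\<Sum>\<sigma>\<in>perms N. gen_weight w N \<sigma> * real (cyc_count N \<sigma> j)))"
    by (simp add: sum_distrib_left sum.distrib[symmetric] algebra_simps)
  also have "\<dots> = fact N * (exp (t * m) * partition_fun w N)"
    unfolding Z M by (simp add: algebra_simps)
  finally show ?thesis unfolding m_def by (rule mult_left_le_imp_le) simp
qed

text \<open>The logarithm of Jensen's inequality combined with the Chernoff bound for the tilted
  weights. The sign of \<open>t\<close> is left open, which later gives both an upper and a lower
  bound.\<close>

lemma mean_count_upper:
  assumes w: "\<And>j. j \<in> {1..N} \<Longrightarrow> 0 \<le> w j" and pos: "0 < partition_fun w N"
    and j: "j \<in> {1..N}" and r: "0 < r"
  shows "t * mean_count w N j \<le> (\<Sum>i=1..N. w i * r ^ i / real i) + (exp t - 1) * (w j * r ^ j / real j)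
     - real N * ln r - ln (partition_fun w N)"
proof -
  let ?w' = "w(j := exp t * w j)"
  have "exp (t * mean_count w N j) * partition_fun w N \<le> partition_fun ?w' N"
    by (rule mean_count_le_tilt[OF w pos j])
  also have "\<dots> \<le> exp (\<Sum>i=1..N. ?w' i * r ^ i / real i) / r ^ N"
    using w r j by (intro partition_fun_upper) auto
  also have "(\<Sum>i=1..N. ?w' i * r ^ i / real i) =
     (\<Sum>i=1..N. w i * r ^ i / real i) + (exp t - 1) * (w j * r ^ j / real j)"
  proof -
    have "(\<Sum>i=1..N. ?w' i * r ^ i / real i) =
      (\<Sum>i=1..N. w i * r ^ i / real i + (if i = j then (exp t - 1) * (w j * r ^ j / real j) else 0))"
      by (intro sum.cong) (auto simp: algebra_simps diff_divide_distrib)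
    then show ?thesis unfolding sum.distrib using j by (subst (asm) sum.delta) simp_all
  qed
  finally have "ln (exp (t * mean_count w N j) * partition_fun w N) \<le>
     ln (exp ((\<Sum>i=1..N. w i * r ^ i / real i) + (exp t - 1) * (w j * r ^ j / real j)) / r ^ N)"
    using pos r by (subst ln_le_cancel_iff) auto
  then show ?thesis using pos r by (simp add: ln_mult ln_div ln_realpow)
qed

lemma H_N_eq: "H_N \<theta> \<kappa> N = partition_fun (\<lambda>j. \<theta> j + real N * \<kappa> j) N"
  by (simp add: H_N_def partition_fun_def weight_def gen_weight_def)

text \<open>Since the cycle lengths add up to \<open>N\<close>, the tail is the complement of the
  \<open>K\<close> shortest lengths, and only finitely many mean counts matter.\<close>

lemma tail_mass_eq:
  fixes \<theta> \<kappa> :: "nat \<Rightarrow> real"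
  defines "w \<equiv> \<lambda>N j. \<theta> j + real N * \<kappa> j"
  assumes pos: "0 < partition_fun (w N) N" and "K \<le> N" "1 \<le> N"
  shows "tail_mass \<theta> \<kappa> K N = 1 - (\<Sum>j=1..K. real j * (mean_count (w N) N j / real N))"
proof -
  let ?Z = "fact N * partition_fun (w N) N"
  have Z: "(\<Sum>\<sigma>\<in>perms N. gen_weight (w N) N \<sigma>) = ?Z"
    by (simp add: partition_fun_def)
  have split: "(\<Sum>j\<in>{K<..N}. real j * real (cyc_count N \<sigma> j)) =
     real N - (\<Sum>j=1..K. real j * real (cyc_count N \<sigma> j))" if "\<sigma> \<in> perms N" for \<sigma>
  proof -
    have "{1..N} = {1..K} \<union> {K<..N}" using assms by auto
    then have "(\<Sum>j=1..N. real j * real (cyc_count N \<sigma> j)) =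
      (\<Sum>j=1..K. real j * real (cyc_count N \<sigma> j)) + (\<Sum>j\<in>{K<..N}. real j * real (cyc_count N \<sigma> j))"
      by (simp only:) (rule sum.union_disjoint, auto)
    then show ?thesis using sum_cycle_lengths[of \<sigma> N] that by (simp add: perms_def)
  qed
  have "expect_N \<theta> \<kappa> N (\<lambda>\<sigma>. \<Sum>j\<in>{K<..N}. real j * real (cyc_count N \<sigma> j)) =
    (\<Sum>\<sigma>\<in>perms N. gen_weight (w N) N \<sigma> / ?Z * (real N - (\<Sum>j=1..K. real j * real (cyc_count N \<sigma> j))))"
    unfolding expect_N_def prob_N_def H_N_eq
    by (intro sum.cong refl) (simp add: weight_def gen_weight_def split w_def)
  also have "\<dots> = (\<Sum>\<sigma>\<in>perms N. gen_weight (w N) N \<sigma>) / ?Z * real N -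
     (\<Sum>\<sigma>\<in>perms N. \<Sum>j=1..K. gen_weight (w N) N \<sigma> / ?Z * (real j * real (cyc_count N \<sigma> j)))"
    by (simp only: right_diff_distrib sum_subtractf sum_distrib_left sum_distrib_right sum_divide_distrib)
  also have "(\<Sum>\<sigma>\<in>perms N. \<Sum>j=1..K. gen_weight (w N) N \<sigma> / ?Z * (real j * real (cyc_count N \<sigma> j)))
     = (\<Sum>j=1..K. real j * mean_count (w N) N j)"
    unfolding mean_count_def sum_distrib_left sum_divide_distrib
    by (subst sum.swap) (simp add: mult_ac)
  finally have "tail_mass \<theta> \<kappa> K N = (real N - (\<Sum>j=1..K. real j * mean_count (w N) N j)) / real N"
    using pos by (simp add: tail_mass_def Z)
  then show ?thesis using assms by (simp add: diff_divide_distrib sum_divide_distrib)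
qed

subsection \<open>Exponential lower bound\<close>

text \<open>Supplies the coefficients that repair rounding errors in the total cycle length.\<close>

lemma bezout_finite_nat:
  fixes J :: "nat set"
  assumes "finite J"
  shows "\<exists>b::nat \<Rightarrow> int. (\<Sum>j\<in>J. b j * int j) = int (Gcd J)"
  using assms
proof induction
  case empty
  then show ?case by simp
next
  case (insert x J)
  then obtain b where b: "(\<Sum>j\<in>J. b j * int j) = int (Gcd J)" by blast
  obtain s t where st: "s * int x + t * int (Gcd J) = gcd (int x) (int (Gcd J))"
    using bezout_int by blast
  have "(\<Sum>j\<in>insert x J. (if j = x then s else t * b j) * int j) =
      s * int x + (\<Sum>j\<in>J. t * (b j * int j))"
    using insert.hyps by (subst sum.insert) (auto intro!: sum.cong)
  also have "\<dots> = int (Gcd (insert x J))"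
    using st b by (simp add: sum_distrib_left[symmetric] gcd_int_int_eq)
  finally show ?case by (intro exI[of _ "\<lambda>j. if j = x then s else t * b j"]) simp
qed

text \<open>Take a finite subset with least nonzero \<open>Gcd\<close>: adding an element of
  \<open>S\<close> cannot lower it, so it divides all of \<open>S\<close>.\<close>

lemma ex_finite_subset_Gcd_1:
  fixes S :: "nat set"
  assumes "\<And>d. d > 1 \<Longrightarrow> \<exists>j\<in>S. \<not> d dvd j" "\<exists>j\<in>S. j \<noteq> 0"
  shows "\<exists>F. finite F \<and> F \<subseteq> S \<and> Gcd F = 1"
proof -
  let ?P = "\<lambda>F. finite F \<and> F \<subseteq> S \<and> Gcd F \<noteq> 0"
  obtain j where "j \<in> S" "j \<noteq> 0" using assms(2) by blast
  then have "?P {j}" by simp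
  from ex_has_least_nat[of ?P, OF this, of Gcd]
  obtain F where F: "?P F" and min: "\<And>G. ?P G \<Longrightarrow> Gcd F \<le> Gcd G"
    by metis
  have "Gcd F dvd i" if "i \<in> S" for i
  proof -
    have "Gcd (insert i F) dvd Gcd F" by simp
    moreover have "Gcd (insert i F) \<noteq> 0" using F by (metis Gcd_insert gcd_eq_0_iff)
    then have "Gcd F \<le> Gcd (insert i F)" using F that by (intro min) blast
    ultimately have "Gcd (insert i F) = Gcd F"
      using F dvd_imp_le[of "Gcd (insert i F)" "Gcd F"] by linarith
    then show ?thesis by (metis Gcd_dvd insertI1)
  qed
  then have "\<not> Gcd F > 1" using assms(1) by blast
  then have "Gcd F = 1" using F by linarith
  then show ?thesis using F by blast
qed

text \<open>The upper half of Stirling's formula up to an error of order \<open>ln a\<close>; the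
  induction step is ln((a+1)/a) \<ge> 1/(a+1).\<close>

lemma ln_fact_le:
  assumes "1 \<le> a"
  shows "ln (fact a) \<le> real a * ln (real a) - real a + ln (real a) + 1"
  using assms
proof (induction a rule: dec_induct)
  case base
  then show ?case by simp
next
  case (step a)
  have "1 - 1 / (real (Suc a) / real a) \<le> ln (real (Suc a) / real a)"
    using step ln_le_minus_one[of "real a / real (Suc a)"] by (simp add: ln_div)
  then have "1 - real a / real (Suc a) \<le> ln (real (Suc a)) - ln (real a)"
    using step by (simp add: ln_div)
  then have "real (Suc a) * (1 - real a / real (Suc a)) \<le> real (Suc a) * (ln (real (Suc a)) - ln (real a))"
    by (intro mult_left_mono) auto
  then have "1 \<le> real (Suc a) * (ln (real (Suc a)) - ln (real a))"
    by (simp add: field_simps)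
  moreover have "ln (fact (Suc a)) = ln (real (Suc a)) + ln (fact a :: real)"
    using ln_mult[of "real (Suc a)" "fact a"] by simp
  ultimately show ?case using step.IH by (simp add: algebra_simps)
qed

text \<open>The single cycle type with about \<open>N * \<kappa> j * r ^ j / j\<close> cycles of length \<open>j \<in> J\<close> already has the
  right exponential order; the coefficients \<open>b\<close> correct the total length to exactly \<open>N\<close>.\<close>

lemma partition_fun_lower_asymp:
  fixes \<kappa> :: "nat \<Rightarrow> real" and w :: "nat \<Rightarrow> nat \<Rightarrow> real" and b :: "nat \<Rightarrow> int"
  assumes J: "finite J" "0 \<notin> J" and \<kappa>: "\<And>j. j \<in> J \<Longrightarrow> 0 < \<kappa> j"
    and b: "(\<Sum>j\<in>J. b j * int j) = 1"
    and r: "0 < r" "(\<Sum>j\<in>J. \<kappa> j * r ^ j) = 1"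
    and w: "\<And>N j. 1 \<le> j \<Longrightarrow> 0 \<le> w N j" "\<And>N j. j \<in> J \<Longrightarrow> real N * \<kappa> j \<le> w N j"
    and c: "c < (\<Sum>j\<in>J. \<kappa> j * r ^ j / real j) - ln r"
  shows "\<forall>\<^sub>F N in sequentially. 0 < partition_fun (w N) N \<and> c \<le> ln (partition_fun (w N) N) / real N"
proof -
  \<comment> \<open>\<open>q j\<close> is the limiting number of \<open>j\<close>-cycles per point;
    the normalisation of \<open>r\<close> says that \<Sum> j q_j = 1.\<close>
  define q where "q j = \<kappa> j * r ^ j / real j" for j
  \<comment> \<open>\<open>D N\<close> is the length lost by rounding down. Adding
    \<open>D N * b j\<close> to each count restores the total \<open>N\<close>, because \<Sum> b_j j
    = 1.\<close>
  define D where "D N = int N - (\<Sum>j\<in>J. int j * \<lfloor>real N * q j\<rfloor>)" for N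
  define z where "z N j = \<lfloor>real N * q j\<rfloor> + D N * b j" for N j
  define x where "x N j = real_of_int (z N j) / real N" for N j
  define a where "a N j = nat (z N j)" for N j
  \<comment> \<open>\<open>L N\<close> is the Stirling lower bound for the exponential rate of this
    cycle type: the \<open>ln N\<close> terms of weights and factorials cancel, and the last bracket
    is the Stirling error divided by \<open>N\<close>.\<close>
  define L where "L N = (\<Sum>j\<in>J. x N j * (ln (\<kappa> j / real j) - ln (x N j) + 1) -
       (ln (x N j) / real N + ln (real N) / real N + 1 / real N))" for N
  have j0: "0 < j" if "j \<in> J" for j using that J by (cases j) auto
  have q: "0 < q j" "real j * q j = \<kappa> j * r ^ j" if "j \<in> J" for j
    using \<kappa>[OF that] r j0[OF that] by (auto simp: q_def)
  have qsum: "(\<Sum>j\<in>J. real j * q j) = 1" using r q by simp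
  \<comment> \<open>A weighted sum of fractional parts, so the deficit stays bounded and the
    correction does not affect the limiting frequencies.\<close>
  have D: "real_of_int (D N) = (\<Sum>j\<in>J. real j * frac (real N * q j))" for N
  proof -
    have "real_of_int (D N) = real N * (\<Sum>j\<in>J. real j * q j) - (\<Sum>j\<in>J. real j * real_of_int \<lfloor>real N * q j\<rfloor>)"
      by (simp add: D_def qsum)
    also have "\<dots> = (\<Sum>j\<in>J. real j * frac (real N * q j))"
      by (simp add: frac_def sum_distrib_left sum_subtractf[symmetric] algebra_simps)
    finally show ?thesis .
  qed
  have Dabs: "\<bar>real_of_int (D N)\<bar> \<le> (\<Sum>j\<in>J. real j)" for N
  proof -
    have "0 \<le> real j * frac (real N * q j) \<and> real j * frac (real N * q j) \<le> real j * 1" for j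
      by (intro conjI mult_nonneg_nonneg mult_left_mono) (auto intro: less_imp_le frac_lt_1)
    then have "0 \<le> real_of_int (D N)" "real_of_int (D N) \<le> (\<Sum>j\<in>J. real j)"
      unfolding D by (auto intro!: sum_nonneg sum_mono)
    then show ?thesis by simp
  qed
  have zsum: "(\<Sum>j\<in>J. int j * z N j) = int N" for N
  proof -
    have "(\<Sum>j\<in>J. int j * z N j) = (\<Sum>j\<in>J. int j * \<lfloor>real N * q j\<rfloor>) + D N * (\<Sum>j\<in>J. b j * int j)"
      by (simp add: z_def distrib_left sum.distrib sum_distrib_left mult_ac)
    then show ?thesis by (simp add: b D_def)
  qed
  have x: "(\<lambda>N. x N j) \<longlonglongrightarrow> q j" for j
  proof -
    define B where "B = 1 + (\<Sum>j\<in>J. real j) * \<bar>real_of_int (b j)\<bar>"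
    have "norm (x N j - q j) \<le> B / real N" if "1 \<le> N" for N
    proof -
      have "\<bar>real_of_int (z N j) - real N * q j\<bar> \<le>
          \<bar>real_of_int \<lfloor>real N * q j\<rfloor> - real N * q j\<bar> + \<bar>real_of_int (D N) * real_of_int (b j)\<bar>"
        unfolding z_def of_int_add of_int_mult by linarith
      also have "\<dots> \<le> 1 + (\<Sum>j\<in>J. real j) * \<bar>real_of_int (b j)\<bar>"
        unfolding abs_mult by (intro add_mono mult_right_mono Dabs) linarith+
      finally have "\<bar>real_of_int (z N j) - real N * q j\<bar> / real N \<le> B / real N"
        unfolding B_def by (intro divide_right_mono) auto
      moreover have "x N j - q j = (real_of_int (z N j) - real N * q j) / real N"
        using that by (simp add: x_def field_simps)
      ultimately show ?thesis by (simp add: abs_divide)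
    qed
    then have "\<forall>\<^sub>F N in sequentially. norm (x N j - q j) \<le> B / real N"
      by (auto simp: eventually_sequentially)
    moreover have "(\<lambda>N. B / real N) \<longlonglongrightarrow> 0" by (rule lim_const_over_n)
    ultimately have "(\<lambda>N. x N j - q j) \<longlonglongrightarrow> 0" by (rule Lim_null_comparison)
    then show ?thesis by (rule LIM_zero_cancel)
  qed
  have lnN: "(\<lambda>N. ln (real N) / real N) \<longlonglongrightarrow> 0" by (rule lim_ln_over_n)
  have oneN: "(\<lambda>N. 1 / real N) \<longlonglongrightarrow> 0" by (rule lim_const_over_n)
  have lnq: "(\<lambda>N. ln (x N j)) \<longlonglongrightarrow> ln (q j)" if "j \<in> J" for j
    using q[OF that] by (intro tendsto_ln x) auto
  have lnxN: "(\<lambda>N. ln (x N j) / real N) \<longlonglongrightarrow> 0" if "j \<in> J" for j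
    using tendsto_mult[OF lnq[OF that] oneN] by simp
  have "L \<longlonglongrightarrow> (\<Sum>j\<in>J. q j * (ln (\<kappa> j / real j) - ln (q j) + 1) - (0 + 0 + 0))"
    unfolding L_def by (intro tendsto_intros x lnq lnxN lnN oneN) auto
  also have "(\<Sum>j\<in>J. q j * (ln (\<kappa> j / real j) - ln (q j) + 1) - (0 + 0 + 0)) = (\<Sum>j\<in>J. q j) - ln r"
  proof -
    \<comment> \<open>By the form of \<open>q j\<close>, its logarithm differs from ln(\<kappa>_j /
      j) by j ln r, and these terms sum to ln r.\<close>
    have "q j * (ln (\<kappa> j / real j) - ln (q j) + 1) - (0 + 0 + 0) = q j - ln r * (real j * q j)" if "j \<in> J" for j
    proof -
      have "ln (q j) = ln (\<kappa> j / real j * r ^ j)" by (simp add: q_def)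
      also have "\<dots> = ln (\<kappa> j / real j) + real j * ln r"
        using \<kappa>[OF that] r j0[OF that] ln_mult[of "\<kappa> j / real j" "r ^ j"]
        by (simp add: ln_realpow)
      finally show ?thesis by (simp add: algebra_simps)
    qed
    then have "(\<Sum>j\<in>J. q j * (ln (\<kappa> j / real j) - ln (q j) + 1) - (0 + 0 + 0)) =
      (\<Sum>j\<in>J. q j) - ln r * (\<Sum>j\<in>J. real j * q j)"
      by (simp add: sum_subtractf sum_distrib_left)
    then show ?thesis by (simp add: qsum)
  qed
  finally have "\<forall>\<^sub>F N in sequentially. c < L N" using c by (auto simp: q_def dest: order_tendstoD)
  moreover have "\<forall>\<^sub>F N in sequentially. \<forall>j\<in>J. 0 < x N j"
    using J q x by (intro eventually_ball_finite) (auto dest: order_tendstoD)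
  moreover have "\<forall>\<^sub>F N in sequentially. J \<subseteq> {1..N}"
  proof -
    have "\<forall>\<^sub>F N in sequentially. \<forall>j\<in>J. j \<le> N"
      using J by (intro eventually_ball_finite) (auto intro: eventually_ge_at_top)
    then show ?thesis by eventually_elim (use j0 in \<open>auto simp: Suc_le_eq\<close>)
  qed
  ultimately show ?thesis using eventually_gt_at_top[of 0]
  proof eventually_elim
    case (elim N)
    \<comment> \<open>The corrected counts are positive for large \<open>N\<close>, so
      \<open>nat\<close> in \<open>a\<close> loses nothing.\<close>
    have zpos: "0 < z N j" if "j \<in> J" for j
      using elim that by (auto simp: x_def zero_less_divide_iff)
    have a: "1 \<le> a N j" "real (a N j) = real N * x N j" "int (a N j) = z N j" if "j \<in> J" for j
      using zpos[OF that] elim by (auto simp: a_def x_def)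
    have "int (\<Sum>j\<in>J. j * a N j) = int N"
      using zsum[of N] a by simp
    then have asum: "(\<Sum>j\<in>J. j * a N j) = N" by linarith
    \<comment> \<open>The contribution of the cycle type with each weight replaced by its lower
      bound \<open>real N * \<kappa> j\<close>.\<close>
    define P where "P = (\<Prod>j\<in>J. (real N * \<kappa> j / real j) ^ a N j / fact (a N j))"
    have fac: "0 < (real N * \<kappa> j / real j) ^ a N j / fact (a N j)" if "j \<in> J" for j
      using \<kappa>[OF that] j0[OF that] elim by simp
    have Ppos: "0 < P" unfolding P_def by (intro prod_pos fac)
    have "P \<le> (\<Prod>j\<in>J. (w N j / real j) ^ a N j / fact (a N j))"
      unfolding P_def
      by (intro prod_mono conjI less_imp_le[OF fac] divide_right_mono power_mono w)
         (use \<kappa> in \<open>auto intro!: mult_nonneg_nonneg divide_nonneg_nonneg intro: less_imp_le\<close>)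
    also have "\<dots> \<le> partition_fun (w N) N"
      using elim w by (intro partition_fun_lower asum) auto
    finally have P: "P \<le> partition_fun (w N) N" .
    have "L N * real N \<le> ln P"
    proof -
      have "ln P = (\<Sum>j\<in>J. ln ((real N * \<kappa> j / real j) ^ a N j / fact (a N j)))"
        unfolding P_def by (intro ln_prod J less_imp_neq[OF fac, symmetric])
      moreover have "(x N j * (ln (\<kappa> j / real j) - ln (x N j) + 1) -
         (ln (x N j) / real N + ln (real N) / real N + 1 / real N)) * real N
         \<le> ln ((real N * \<kappa> j / real j) ^ a N j / fact (a N j))" if "j \<in> J" for j
      proof -
        have xp: "0 < x N j" using elim that by auto
        have "ln (real N * \<kappa> j / real j) = ln (real N) + ln (\<kappa> j / real j)"
          using \<kappa>[OF that] j0[OF that] elim ln_mult[of "real N" "\<kappa> j / real j"] by simp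
        then have "ln ((real N * \<kappa> j / real j) ^ a N j / fact (a N j)) =
          real (a N j) * (ln (real N) + ln (\<kappa> j / real j)) - ln (fact (a N j))"
          using \<kappa>[OF that] j0[OF that] elim by (simp add: ln_div ln_realpow)
        moreover have "ln (fact (a N j)) \<le>
            real (a N j) * ln (real (a N j)) - real (a N j) + ln (real (a N j)) + 1"
          by (rule ln_fact_le[OF a(1)[OF that]])
        moreover have "ln (real (a N j)) = ln (real N) + ln (x N j)"
          using elim xp unfolding a(2)[OF that] by (simp add: ln_mult)
        moreover have "(x N j * (ln (\<kappa> j / real j) - ln (x N j) + 1) -
         (ln (x N j) / real N + ln (real N) / real N + 1 / real N)) * real N =
           real (a N j) * (ln (\<kappa> j / real j) - ln (x N j) + 1) - (ln (x N j) + ln (real N) + 1)"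
          using elim unfolding a(2)[OF that] by (simp add: field_simps)
        ultimately show ?thesis by (simp add: algebra_simps)
      qed
      ultimately show ?thesis unfolding L_def sum_distrib_right by (auto intro: sum_mono)
    qed
    also have "\<dots> \<le> ln (partition_fun (w N) N)" using P Ppos by simp
    finally have "L N \<le> ln (partition_fun (w N) N) / real N"
      using elim by (simp add: field_simps)
    then show ?case using elim P Ppos by auto
  qed
qed

subsection \<open>The limit of the mean cycle counts\<close>

lemma sum_gcoeff: "(\<Sum>j\<le>n. gcoeff a j * x ^ j) = (\<Sum>j=1..n. a j * x ^ j / real j)"
proof -
  have "{..n} = insert 0 {1..n}" by auto
  then have "(\<Sum>j\<le>n. gcoeff a j * x ^ j) = (\<Sum>j=1..n. gcoeff a j * x ^ j)"
    by (simp add: gcoeff_def)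
  then show ?thesis by (simp add: gcoeff_def)
qed

lemma gcoeff_nonneg: "(\<And>j. 1 \<le> j \<Longrightarrow> 0 \<le> a j) \<Longrightarrow> 0 \<le> gcoeff a j"
  by (simp add: gcoeff_def)

lemma summable_gcoeff:
  assumes "\<And>j. 1 \<le> j \<Longrightarrow> 0 \<le> a j" "0 \<le> r" "\<And>n. (\<Sum>j=1..n. a j * r ^ j) \<le> s"
  shows "summable (\<lambda>j. gcoeff a j * r ^ j)"
proof (rule bounded_imp_summable)
  show "0 \<le> gcoeff a j * r ^ j" for j using assms by (simp add: gcoeff_nonneg)
  show "(\<Sum>j\<le>n. gcoeff a j * r ^ j) \<le> s" for n
  proof -
    have "a j * r ^ j / real j \<le> a j * r ^ j" if "j \<in> {1..n}" for j
    proof -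
      have "a j * r ^ j * 1 \<le> a j * r ^ j * real j"
        using that assms by (intro mult_left_mono) auto
      then show ?thesis using that by (simp add: divide_le_eq)
    qed
    then have "(\<Sum>j=1..n. a j * r ^ j / real j) \<le> (\<Sum>j=1..n. a j * r ^ j)" by (rule sum_mono)
    then show ?thesis unfolding sum_gcoeff using assms(3)[of n] by simp
  qed
qed

text \<open>An abstraction of \<open>r_*\<close>: by \<open>le_1\<close> and \<open>ge_1\<close> the
  sum \<Sum> \<kappa>_j r^j passes 1 at \<open>\<rho>\<close>, either by attaining 1 there or by
  jumping to infinity beyond it. \<open>\<theta>_summable\<close> stops short of
  \<open>\<rho>\<close> because g_\<theta> may diverge there.\<close>

locale tilted_weights =
  fixes \<theta> \<kappa> :: "nat \<Rightarrow> real" and \<rho> :: real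
  assumes \<theta>: "\<And>j. 1 \<le> j \<Longrightarrow> 0 \<le> \<theta> j" and \<kappa>: "\<And>j. 1 \<le> j \<Longrightarrow> 0 \<le> \<kappa> j"
    and nonarith: "\<And>d. 1 < d \<Longrightarrow> \<exists>j\<ge>1. \<kappa> j \<noteq> 0 \<and> \<not> d dvd j"
    and \<rho>: "0 < \<rho>"
    and \<theta>_summable: "\<And>r. 0 < r \<Longrightarrow> r < \<rho> \<Longrightarrow> summable (\<lambda>j. gcoeff \<theta> j * r ^ j)"
    and le_1: "\<And>M. (\<Sum>j=1..M. \<kappa> j * \<rho> ^ j) \<le> 1"
    and ge_1: "\<And>r. \<rho> < r \<Longrightarrow> \<exists>M. 1 \<le> (\<Sum>j=1..M. \<kappa> j * r ^ j)"
begin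

definition w :: "nat \<Rightarrow> nat \<Rightarrow> real" where "w N j = \<theta> j + real N * \<kappa> j"

lemma w_nonneg: "1 \<le> j \<Longrightarrow> 0 \<le> w N j"
  using \<theta> \<kappa> by (simp add: w_def)

lemma \<kappa>_summable: "summable (\<lambda>j. gcoeff \<kappa> j * \<rho> ^ j)"
  using \<kappa> \<rho> le_1 by (intro summable_gcoeff) auto

text \<open>The value g_\<kappa>(\<rho>), which is finite by \<open>le_1\<close> even if
  \<open>\<rho>\<close> is the radius of convergence.\<close>

definition G :: real where "G = (\<Sum>j. gcoeff \<kappa> j * \<rho> ^ j)"

lemma G_ge: "(\<Sum>j=1..n. \<kappa> j * \<rho> ^ j / real j) \<le> G"
  unfolding sum_gcoeff[symmetric] G_def using \<rho> \<kappa>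
  by (intro sum_le_suminf \<kappa>_summable) (auto simp: gcoeff_nonneg)

lemma partition_fun_lower_limit:
  assumes "0 < \<epsilon>"
  shows "\<forall>\<^sub>F N in sequentially. 0 < partition_fun (w N) N \<and>
    G - ln \<rho> - \<epsilon> \<le> ln (partition_fun (w N) N) / real N"
proof -
  let ?S = "{j. 1 \<le> j \<and> \<kappa> j \<noteq> 0}"
  have "\<exists>j\<in>?S. j \<noteq> 0"
    using nonarith[of 2] by fastforce
  then obtain F where F: "finite F" "F \<subseteq> ?S" "Gcd F = 1"
    using ex_finite_subset_Gcd_1[of ?S] nonarith by fastforce
  \<comment> \<open>The move from \<open>\<rho>\<close> to \<open>\<rho>'\<close> costs
    \<open>\<epsilon> / 4\<close> in the logarithm; truncating \<open>G\<close> costs another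
    \<open>\<epsilon> / 4\<close>.\<close>
  define \<rho>' where "\<rho>' = \<rho> * exp (\<epsilon> / 4)"
  have \<rho>': "\<rho> < \<rho>'" "ln \<rho>' = ln \<rho> + \<epsilon> / 4" using \<rho> assms by (auto simp: \<rho>'_def ln_mult)
  obtain M1 where M1: "1 \<le> (\<Sum>j=1..M1. \<kappa> j * \<rho>' ^ j)" using ge_1[OF \<rho>'(1)] by blast
  have "(\<lambda>n. \<Sum>j=1..n. \<kappa> j * \<rho> ^ j / real j) \<longlonglongrightarrow> G"
    using summable_LIMSEQ'[OF \<kappa>_summable] by (simp only: sum_gcoeff G_def)
  then have "\<forall>\<^sub>F n in sequentially. G - \<epsilon> / 4 < (\<Sum>j=1..n. \<kappa> j * \<rho> ^ j / real j)"
    using assms by (intro order_tendstoD) auto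
  \<comment> \<open>The cutoff must capture most of \<open>G\<close>, let the sum at
    \<open>\<rho>'\<close> reach 1, and include \<open>F\<close>, which makes the lengths
    coprime.\<close>
  then have "\<forall>\<^sub>F n in sequentially. G - \<epsilon> / 4 < (\<Sum>j=1..n. \<kappa> j * \<rho> ^ j / real j) \<and> M1 \<le> n \<and> (\<forall>j\<in>F. j \<le> n)"
    using F(1) by (intro eventually_conj eventually_ge_at_top eventually_ball_finite) auto
  then obtain M where M: "G - \<epsilon> / 4 < (\<Sum>j=1..M. \<kappa> j * \<rho> ^ j / real j)" "M1 \<le> M" "\<And>j. j \<in> F \<Longrightarrow> j \<le> M"
    by (auto simp: eventually_sequentially)
  define J where "J = {j \<in> {1..M}. \<kappa> j \<noteq> 0}"
  have J: "finite J" "0 \<notin> J" "\<And>j. j \<in> J \<Longrightarrow> 0 < \<kappa> j" "F \<subseteq> J"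
    using \<kappa> F M(3) by (fastforce simp: J_def)+
  have J_sum: "(\<Sum>j\<in>J. \<kappa> j * f j) = (\<Sum>j=1..M. \<kappa> j * f j)" for f
    by (rule sum.mono_neutral_left) (auto simp: J_def)
  have "Gcd J dvd Gcd F" using J(4) by (intro Gcd_greatest) (auto intro: Gcd_dvd)
  then have "Gcd J = 1" using F(3) by simp
  then obtain b :: "nat \<Rightarrow> int" where b: "(\<Sum>j\<in>J. b j * int j) = 1"
    using bezout_finite_nat[OF J(1)] by auto
  \<comment> \<open>The truncated sum is at most 1 at \<open>\<rho>\<close> and at least 1 at
    \<open>\<rho>'\<close>, so it equals 1 in between.\<close>
  have "\<exists>r. \<rho> \<le> r \<and> r \<le> \<rho>' \<and> (\<Sum>j\<in>J. \<kappa> j * r ^ j) = 1"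
  proof (rule IVT')
    show "(\<Sum>j\<in>J. \<kappa> j * \<rho> ^ j) \<le> 1" unfolding J_sum by (rule le_1)
    have "(\<Sum>j=1..M1. \<kappa> j * \<rho>' ^ j) \<le> (\<Sum>j=1..M. \<kappa> j * \<rho>' ^ j)"
      using M(2) \<rho> \<rho>' \<kappa> by (intro sum_mono2) auto
    then show "1 \<le> (\<Sum>j\<in>J. \<kappa> j * \<rho>' ^ j)" unfolding J_sum using M1 by simp
  qed (use \<rho>' in \<open>auto intro!: continuous_intros\<close>)
  then obtain r where r: "\<rho> \<le> r" "r \<le> \<rho>'" "(\<Sum>j\<in>J. \<kappa> j * r ^ j) = 1" by blast
  have "(\<Sum>j=1..M. \<kappa> j * \<rho> ^ j / real j) = (\<Sum>j\<in>J. \<kappa> j * \<rho> ^ j / real j)"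
    using J_sum[of "\<lambda>j. \<rho> ^ j / real j"] by simp
  also have "\<dots> \<le> (\<Sum>j\<in>J. \<kappa> j * r ^ j / real j)"
    using \<rho> r J(3) by (intro sum_mono divide_right_mono mult_left_mono power_mono) (auto intro: less_imp_le)
  finally have "G - \<epsilon> / 4 < (\<Sum>j\<in>J. \<kappa> j * r ^ j / real j)" using M(1) by simp
  moreover have "ln r \<le> ln \<rho>'" using r \<rho> by simp
  ultimately have "G - ln \<rho> - \<epsilon> < (\<Sum>j\<in>J. \<kappa> j * r ^ j / real j) - ln r"
    using \<rho>' assms by linarith
  then show ?thesis
    using J b r \<rho> w_nonneg \<theta>
    by (intro partition_fun_lower_asymp[where \<kappa> = \<kappa> and b = b and r = r and J = J])
       (auto simp: w_def J_def)
qed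

text \<open>The upper bound for the tilted and the lower bound for the original partition function
  both contain \<open>N * G\<close>, which cancels. Working at \<open>r < \<rho>\<close> keeps the
  part of \<open>\<theta>\<close> bounded, so that it disappears after division by
  \<open>N\<close>.\<close>

lemma scaled_mean_count_upper:
  assumes "0 < j" "0 < \<delta>"
  shows "\<forall>\<^sub>F N in sequentially. t * (mean_count (w N) N j / real N) <
     (exp t - 1) * (\<kappa> j * \<rho> ^ j / real j) + \<delta>"
proof -
  \<comment> \<open>\<open>A r + \<delta> / 2\<close> is the limit of the bound \<open>B N\<close>
    below; left continuity at \<open>\<rho>\<close> provides an \<open>r\<close> that costs at most
    another \<open>\<delta> / 2\<close>.\<close>
  define A where "A r = (exp t - 1) * (\<kappa> j * r ^ j / real j) + ln \<rho> - ln r" for r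
  have "(A \<longlongrightarrow> (exp t - 1) * (\<kappa> j * \<rho> ^ j / real j) + ln \<rho> - ln \<rho>) (at_left \<rho>)"
    unfolding A_def using \<rho> assms by (auto intro!: tendsto_eq_intros)
  then have "\<forall>\<^sub>F r in at_left \<rho>. A r < (exp t - 1) * (\<kappa> j * \<rho> ^ j / real j) + \<delta> / 2"
    using assms by (intro order_tendstoD) auto
  moreover have "\<forall>\<^sub>F r in at_left \<rho>. 0 < r \<and> r < \<rho>"
    using \<rho> eventually_at_left[OF \<rho>] by blast
  ultimately have "\<forall>\<^sub>F r in at_left \<rho>. A r < (exp t - 1) * (\<kappa> j * \<rho> ^ j / real j) + \<delta> / 2 \<and> 0 < r \<and> r < \<rho>"
    by (rule eventually_conj)
  then obtain r where r: "A r < (exp t - 1) * (\<kappa> j * \<rho> ^ j / real j) + \<delta> / 2" "0 < r" "r < \<rho>"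
    using eventually_happens[of _ "at_left \<rho>"] by (auto simp: trivial_limit_at_left_real)
  define T where "T = (\<Sum>j. gcoeff \<theta> j * r ^ j)"
  have T: "(\<Sum>i=1..N. \<theta> i * r ^ i / real i) \<le> T" for N
    unfolding sum_gcoeff[symmetric] T_def using r \<theta>
    by (intro sum_le_suminf \<theta>_summable) (auto simp: gcoeff_nonneg)
  have Gr: "(\<Sum>i=1..N. \<kappa> i * r ^ i / real i) \<le> G" for N
  proof -
    have "(\<Sum>i=1..N. \<kappa> i * r ^ i / real i) \<le> (\<Sum>i=1..N. \<kappa> i * \<rho> ^ i / real i)"
      using r \<kappa> by (intro sum_mono divide_right_mono mult_left_mono power_mono) auto
    then show ?thesis using G_ge[of N] by simp
  qed
  define B where "B N = T / real N + G + (exp t - 1) * ((\<theta> j / real N + \<kappa> j) * r ^ j / real j)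
      - ln r - (G - ln \<rho> - \<delta> / 2)" for N
  have "B \<longlonglongrightarrow> 0 + G + (exp t - 1) * ((0 + \<kappa> j) * r ^ j / real j) - ln r - (G - ln \<rho> - \<delta> / 2)"
    unfolding B_def using assms by (intro tendsto_intros lim_const_over_n) auto
  moreover have "0 + G + (exp t - 1) * ((0 + \<kappa> j) * r ^ j / real j) - ln r - (G - ln \<rho> - \<delta> / 2)
     < (exp t - 1) * (\<kappa> j * \<rho> ^ j / real j) + \<delta>"
    using r(1) by (simp add: A_def)
  ultimately have B: "\<forall>\<^sub>F N in sequentially. B N < (exp t - 1) * (\<kappa> j * \<rho> ^ j / real j) + \<delta>"
    by (rule order_tendstoD)
  have "0 < \<delta> / 2" using assms by simp
  from B partition_fun_lower_limit[OF this] eventually_ge_at_top[of j]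
  show ?thesis
  proof eventually_elim
    case (elim N)
    then have N: "0 < real N" using assms by simp
    have 1: "t * mean_count (w N) N j \<le>
      (\<Sum>i=1..N. w N i * r ^ i / real i) + (exp t - 1) * (w N j * r ^ j / real j)
       - real N * ln r - ln (partition_fun (w N) N)"
      using elim assms r by (intro mean_count_upper w_nonneg) auto
    have "(\<Sum>i=1..N. w N i * r ^ i / real i) =
        (\<Sum>i=1..N. \<theta> i * r ^ i / real i) + real N * (\<Sum>i=1..N. \<kappa> i * r ^ i / real i)"
      by (simp add: w_def sum.distrib[symmetric] sum_distrib_left algebra_simps add_divide_distrib)
    also have "\<dots> \<le> T + real N * G"
      using T[of N] Gr[of N] by (intro add_mono mult_left_mono) auto
    finally have 2: "(\<Sum>i=1..N. w N i * r ^ i / real i) \<le> T + real N * G" .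
    have 3: "real N * (G - ln \<rho> - \<delta> / 2) \<le> ln (partition_fun (w N) N)"
      using elim N by (simp add: le_divide_eq mult.commute)
    from 1 2 3 have "t * mean_count (w N) N j \<le> T + real N * G + (exp t - 1) * (w N j * r ^ j / real j)
       - real N * ln r - real N * (G - ln \<rho> - \<delta> / 2)" by linarith
    also have "\<dots> = real N * B N"
      using N assms(1) unfolding B_def w_def by (simp add: field_simps)
    finally have "t * (mean_count (w N) N j / real N) \<le> B N"
      using N by (simp add: field_simps)
    then show ?case using elim by simp
  qed
qed

text \<open>Dividing the previous bound by \<open>t\<close> gives an upper bound for
  \<open>t > 0\<close> and a lower one for \<open>t < 0\<close>; both are sharp because (exp t -
  1)/t tends to 1.\<close>

lemma mean_count_limit:
  assumes j: "0 < j"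
  shows "(\<lambda>N. mean_count (w N) N j / real N) \<longlonglongrightarrow> \<kappa> j * \<rho> ^ j / real j"
proof -
  define c where "c = \<kappa> j * \<rho> ^ j / real j"
  have "((\<lambda>t::real. (exp (0 + t) - exp 0) / t) \<longlongrightarrow> exp 0) (at 0)"
    using DERIV_exp[of "0::real"] unfolding DERIV_def .
  then have "((\<lambda>t. (exp t - 1) / t * c) \<longlongrightarrow> 1 * c) (at (0::real))"
    by (intro tendsto_mult tendsto_const) simp
  then have lim: "((\<lambda>t. (exp t - 1) / t * c) \<longlongrightarrow> c) (at (0::real))" by simp
  show ?thesis unfolding c_def[symmetric]
  proof (rule order_tendstoI)
    fix a assume "c < a"
    define e where "e = (a - c) / 2"
    have e: "0 < e" "c + e + e = a" using \<open>c < a\<close> by (auto simp: e_def)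
    have "\<forall>\<^sub>F t in at_right 0. (exp t - 1) / t * c < c + e"
      using order_tendstoD(2)[OF lim, of "c + e"] e by (simp add: eventually_at_split)
    then have "\<forall>\<^sub>F t in at_right 0. (exp t - 1) / t * c < c + e \<and> (0::real) < t"
      by (intro eventually_conj eventually_at_right_less)
    then obtain t where t: "(exp t - 1) / t * c < c + e" "(0::real) < t"
      using eventually_happens[of _ "at_right (0::real)"] by (auto simp: trivial_limit_at_right_real)
    \<comment> \<open>The error is chosen as \<open>t * e\<close>, so that division by
      \<open>t\<close> leaves \<open>e\<close>.\<close>
    have "\<forall>\<^sub>F N in sequentially. t * (mean_count (w N) N j / real N) < (exp t - 1) * c + t * e"
      unfolding c_def using t e j by (intro scaled_mean_count_upper) auto
    then show "\<forall>\<^sub>F N in sequentially. mean_count (w N) N j / real N < a"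
    proof eventually_elim
      case (elim N)
      have "t * (mean_count (w N) N j / real N) < t * ((exp t - 1) / t * c) + t * e"
        using elim t by simp
      also have "\<dots> \<le> t * (c + e) + t * e"
        using t by (intro add_right_mono mult_left_mono) auto
      also have "\<dots> = t * a" using e by (simp add: algebra_simps flip: e(2))
      finally show ?case using t by (simp only: mult_less_cancel_left_pos)
    qed
  next
    fix a assume "a < c"
    define e where "e = (c - a) / 2"
    have e: "0 < e" "c - e - e = a" using \<open>a < c\<close> by (auto simp: e_def)
    have "\<forall>\<^sub>F t in at_left 0. c - e < (exp t - 1) / t * c"
      using order_tendstoD(1)[OF lim, of "c - e"] e by (simp add: eventually_at_split)
    moreover have "\<forall>\<^sub>F t in at_left 0. t < (0::real)"
      by (simp add: eventually_at_filter)
    ultimately have "\<forall>\<^sub>F t in at_left 0. c - e < (exp t - 1) / t * c \<and> t < (0::real)"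
      by (intro eventually_conj)
    then obtain t where t: "c - e < (exp t - 1) / t * c" "t < (0::real)"
      using eventually_happens[of _ "at_left (0::real)"] by (auto simp: trivial_limit_at_left_real)
    \<comment> \<open>Here \<open>t < 0\<close>: the positive error is \<open>- t * e\<close>, and
      division by \<open>t\<close> reverses the inequality.\<close>
    have "\<forall>\<^sub>F N in sequentially. t * (mean_count (w N) N j / real N) < (exp t - 1) * c + (- t) * e"
      unfolding c_def using t e j by (intro scaled_mean_count_upper) (auto intro: mult_neg_pos)
    then show "\<forall>\<^sub>F N in sequentially. a < mean_count (w N) N j / real N"
    proof eventually_elim
      case (elim N)
      have "t * (mean_count (w N) N j / real N) < t * ((exp t - 1) / t * c) + (- t) * e"
        using elim t by simp
      also have "\<dots> \<le> t * (c - e) + (- t) * e"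
        using t by (intro add_right_mono mult_left_mono_neg) auto
      also have "\<dots> = t * a" by (simp add: algebra_simps flip: e(2))
      finally show ?case using t by (simp only: mult_less_cancel_left_neg)
    qed
  qed
qed

lemma tail_mass_limit: "tail_mass \<theta> \<kappa> K \<longlonglongrightarrow> 1 - (\<Sum>j=1..K. \<kappa> j * \<rho> ^ j)"
proof -
  have "(\<lambda>N. 1 - (\<Sum>j=1..K. real j * (mean_count (w N) N j / real N))) \<longlonglongrightarrow>
      1 - (\<Sum>j=1..K. real j * (\<kappa> j * \<rho> ^ j / real j))"
    by (intro tendsto_intros mean_count_limit) auto
  moreover have "\<forall>\<^sub>F N in sequentially.
      1 - (\<Sum>j=1..K. real j * (mean_count (w N) N j / real N)) = tail_mass \<theta> \<kappa> K N"
    using partition_fun_lower_limit[OF zero_less_one] eventually_ge_at_top[of "max 1 K"]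
    by eventually_elim (subst tail_mass_eq, auto simp: w_def[abs_def])
  ultimately have "tail_mass \<theta> \<kappa> K \<longlonglongrightarrow> 1 - (\<Sum>j=1..K. real j * (\<kappa> j * \<rho> ^ j / real j))"
    by (rule Lim_transform_eventually)
  then show ?thesis by simp
qed

end

subsection \<open>The value of \<open>z g_\<kappa>'(z)\<close> up to the radius of convergence\<close>

definition psum :: "(nat \<Rightarrow> real) \<Rightarrow> nat \<Rightarrow> real \<Rightarrow> real" where
  "psum \<kappa> n r = (\<Sum>j=1..n. \<kappa> j * r ^ j)"

text \<open>For nonnegative \<open>\<kappa>\<close> and \<open>r\<close> this is the extended-real
  value of r g_\<kappa>'(r), meaningful also at and beyond the radius of convergence.\<close>

definition psum_sup :: "(nat \<Rightarrow> real) \<Rightarrow> real \<Rightarrow> ereal" where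
  "psum_sup \<kappa> r = (SUP n. ereal (psum \<kappa> n r))"

lemma gder_1_eq:
  assumes "\<bar>ereal r\<bar> < radius a"
  shows "gder a 1 r = r * (\<Sum>n. diffs (gcoeff a) n * r ^ n)"
proof -
  obtain K where K: "\<bar>ereal r\<bar> < ereal K" "ereal K < radius a"
    using ereal_dense2[OF assms] by blast
  have "summable (\<lambda>n. gcoeff a n * K ^ n)"
    using K by (intro summable_in_conv_radius) (auto simp: radius_def)
  then have "DERIV (gR a) r :> (\<Sum>n. diffs (gcoeff a) n * r ^ n)"
    unfolding gR_def using K by (intro termdiffs_strong) auto
  then show ?thesis by (simp add: gder_def DERIV_imp_deriv)
qed

lemma summable_diffs_gcoeff:
  assumes "\<bar>ereal r\<bar> < radius a"
  shows "summable (\<lambda>n. diffs (gcoeff a) n * r ^ n)"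
proof -
  obtain K where K: "\<bar>ereal r\<bar> < ereal K" "ereal K < radius a"
    using ereal_dense2[OF assms] by blast
  show ?thesis
  proof (rule termdiff_converges)
    show "norm r < K" using K by simp
    show "summable (\<lambda>n. gcoeff a n * x ^ n)" if "norm x < K" for x
    proof (rule summable_in_conv_radius)
      have "ereal (norm x) < ereal K" using that by simp
      also note K(2)
      finally show "ereal (norm x) < conv_radius (gcoeff a)" by (simp add: radius_def)
    qed
  qed
qed

lemma isCont_gder_1:
  assumes "\<bar>ereal r\<bar> < radius a"
  shows "isCont (gder a 1) r"
proof -
  obtain K where K: "\<bar>ereal r\<bar> < ereal K" "ereal K < radius a"
    using ereal_dense2[OF assms] by blast
  have "summable (\<lambda>n. diffs (gcoeff a) n * K ^ n)"
    using K by (intro summable_diffs_gcoeff) (cases "0 \<le> K"; auto)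
  then have "isCont (\<lambda>r. r * (\<Sum>n. diffs (gcoeff a) n * r ^ n)) r"
    using K by (intro continuous_intros isCont_powser[of _ K]) auto
  moreover have eq: "\<forall>\<^sub>F y in nhds r. y * (\<Sum>n. diffs (gcoeff a) n * y ^ n) = gder a 1 y"
  proof -
    have "\<forall>\<^sub>F y in nhds r. y \<in> {-K<..<K}"
      using K by (intro eventually_nhds_in_open) (auto simp: abs_if split: if_splits)
    then show ?thesis
    proof eventually_elim
      case (elim y)
      then have "\<bar>ereal y\<bar> < ereal K" by auto
      then have "\<bar>ereal y\<bar> < radius a" using K(2) by (rule less_trans)
      then show ?case by (rule gder_1_eq[symmetric])
    qed
  qed
  ultimately show ?thesis using isCont_cong[OF eq] by simp
qed

text \<open>The factor \<open>j\<close> from differentiation cancels the denominator in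
  \<open>gcoeff\<close>.\<close>

lemma psum_tendsto_gder:
  assumes "\<bar>ereal r\<bar> < radius a"
  shows "(\<lambda>n. psum a n r) \<longlonglongrightarrow> gder a 1 r"
proof -
  have "(\<lambda>n. \<Sum>j<n. diffs (gcoeff a) j * r ^ j) \<longlonglongrightarrow> (\<Sum>n. diffs (gcoeff a) n * r ^ n)"
    by (intro summable_LIMSEQ summable_diffs_gcoeff assms)
  then have "(\<lambda>n. r * (\<Sum>j<n. diffs (gcoeff a) j * r ^ j)) \<longlonglongrightarrow> r * (\<Sum>n. diffs (gcoeff a) n * r ^ n)"
    by (rule tendsto_mult_left)
  moreover have "r * (\<Sum>j<n. diffs (gcoeff a) j * r ^ j) = psum a n r" for n
    unfolding sum_distrib_left psum_def
    by (rule sum.reindex_bij_witness[of _ "\<lambda>j. j - 1" Suc]) (auto simp: diffs_def gcoeff_def)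
  ultimately show ?thesis using gder_1_eq[OF assms] by simp
qed

section \<open>Extended-real sums with nonnegative coefficients\<close>

locale nonneg_weights =
  fixes \<kappa> :: "nat \<Rightarrow> real"
  assumes \<kappa>: "\<And>j. 1 \<le> j \<Longrightarrow> 0 \<le> \<kappa> j" and \<kappa>_pos: "\<exists>j\<ge>1. 0 < \<kappa> j"
    and radius_pos: "0 < radius \<kappa>"
begin

lemma psum_mono: "0 \<le> r \<Longrightarrow> m \<le> n \<Longrightarrow> psum \<kappa> m r \<le> psum \<kappa> n r"
  unfolding psum_def using \<kappa> by (intro sum_mono2) auto

lemma psum_mono_arg: "0 \<le> r \<Longrightarrow> r \<le> r' \<Longrightarrow> psum \<kappa> n r \<le> psum \<kappa> n r'"
  unfolding psum_def using \<kappa> by (intro sum_mono mult_left_mono power_mono) auto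

lemma psum_le_sup: "ereal (psum \<kappa> n r) \<le> psum_sup \<kappa> r"
  unfolding psum_sup_def by (rule SUP_upper) simp

lemma psum_sup_nonneg: "0 \<le> psum_sup \<kappa> r"
  using psum_le_sup[of 0 r] by (simp add: psum_def zero_ereal_def)

lemma psum_tendsto_sup: "0 \<le> r \<Longrightarrow> (\<lambda>n. ereal (psum \<kappa> n r)) \<longlonglongrightarrow> psum_sup \<kappa> r"
  unfolding psum_sup_def by (intro LIMSEQ_SUP) (auto simp: incseq_def psum_mono)

lemma psum_sup_eq_gder:
  assumes "0 \<le> r" "ereal r < radius \<kappa>"
  shows "psum_sup \<kappa> r = ereal (gder \<kappa> 1 r)"
proof (rule LIMSEQ_unique[OF psum_tendsto_sup[OF assms(1)]])
  show "(\<lambda>n. ereal (psum \<kappa> n r)) \<longlonglongrightarrow> ereal (gder \<kappa> 1 r)"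
    using assms by (intro tendsto_ereal psum_tendsto_gder) auto
qed

text \<open>One positive coefficient already gains a fixed \<open>d\<close> in all late partial
  sums, and this gain survives the limit because the sum at \<open>r\<close> is finite.\<close>

lemma psum_sup_strict_mono:
  assumes "0 \<le> r" "r < r'" "psum_sup \<kappa> r < \<infinity>"
  shows "psum_sup \<kappa> r < psum_sup \<kappa> r'"
proof (rule ccontr)
  assume "\<not> psum_sup \<kappa> r < psum_sup \<kappa> r'"
  then have le: "psum_sup \<kappa> r' \<le> psum_sup \<kappa> r" by simp
  obtain s where s: "psum_sup \<kappa> r = ereal s"
    using assms(3) psum_sup_nonneg[of r] by (cases "psum_sup \<kappa> r") auto
  obtain i where i: "1 \<le> i" "0 < \<kappa> i" using \<kappa>_pos by blast
  define d where "d = \<kappa> i * (r' ^ i - r ^ i)"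
  have d: "0 < d" unfolding d_def using i assms by (intro mult_pos_pos) (auto intro: power_strict_mono)
  have "psum \<kappa> n r + d \<le> s" if "i \<le> n" for n
  proof -
    have "d \<le> (\<Sum>j=1..n. \<kappa> j * (r' ^ j - r ^ j))"
      unfolding d_def using i that assms \<kappa>
      by (intro member_le_sum[of i "{1..n}" "\<lambda>j. \<kappa> j * (r' ^ j - r ^ j)"])
         (auto intro!: mult_nonneg_nonneg power_mono)
    then have "psum \<kappa> n r + d \<le> psum \<kappa> n r'"
      by (simp add: psum_def right_diff_distrib sum_subtractf)
    also have "ereal (psum \<kappa> n r') \<le> ereal s" using psum_le_sup[of n r'] le s by (metis order_trans)
    then have "psum \<kappa> n r' \<le> s" by simp
    finally show ?thesis .
  qed
  moreover have "(\<lambda>n. psum \<kappa> n r + d) \<longlonglongrightarrow> s + d"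
    using psum_tendsto_sup[OF assms(1)] s by (intro tendsto_intros) simp
  ultimately have "s + d \<le> s" by (intro LIMSEQ_le_const2) auto
  then show False using d by simp
qed

text \<open>Bounded partial sums would make g_\<kappa> converge at a point beyond its
  radius.\<close>

lemma psum_sup_eq_infinity:
  assumes "radius \<kappa> < ereal r"
  shows "psum_sup \<kappa> r = \<infinity>"
proof (rule ccontr)
  assume *: "psum_sup \<kappa> r \<noteq> \<infinity>"
  have r: "0 < r" using radius_pos assms by (metis ereal_less(2) less_trans)
  obtain s where s: "psum_sup \<kappa> r = ereal s"
    using * psum_sup_nonneg[of r] by (cases "psum_sup \<kappa> r") auto
  have "psum \<kappa> n r \<le> s" for n using psum_le_sup[of n r] s by simp
  then have "summable (\<lambda>j. gcoeff \<kappa> j * r ^ j)"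
    using \<kappa> r unfolding psum_def by (intro summable_gcoeff) auto
  then have "ereal (norm r) \<le> conv_radius (gcoeff \<kappa>)" by (rule conv_radius_geI)
  then show False using assms r by (simp add: radius_def)
qed

section \<open>Limits along r increasing to the radius of convergence\<close>

definition to_radius :: "real filter" where
  "to_radius = (if radius \<kappa> = \<infinity> then at_top else at_left (real_of_ereal (radius \<kappa>)))"

lemma to_radius_nontrivial: "to_radius \<noteq> bot"
  by (simp add: to_radius_def trivial_limit_at_left_real)

lemma eventually_to_radius: "\<forall>\<^sub>F r in to_radius. 0 < r \<and> ereal r < radius \<kappa>"
proof (cases "radius \<kappa>")
  case (real R)
  then have "0 < R" using radius_pos by simp
  then show ?thesis using real eventually_at_left[of 0 R] by (auto simp: to_radius_def)
next
  case PInf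
  then show ?thesis by (simp add: to_radius_def eventually_gt_at_top)
qed (use radius_pos in auto)

lemma gderR_eq:
  assumes "((\<lambda>r. ereal (gder \<kappa> n r)) \<longlongrightarrow> l) to_radius"
  shows "gderR \<kappa> n = l"
  unfolding gderR_def Let_def using assms to_radius_nontrivial
  by (intro tendsto_Lim) (auto simp: to_radius_def)

text \<open>Monotone convergence: a partial sum exceeding \<open>a\<close> at \<open>R\<close> does
  so nearby by continuity, and monotonicity in \<open>r\<close> gives the bound from above.\<close>

lemma gder_tendsto_finite:
  assumes "radius \<kappa> = ereal R"
  shows "((\<lambda>r. ereal (gder \<kappa> 1 r)) \<longlongrightarrow> psum_sup \<kappa> R) to_radius"
proof (rule order_tendstoI)
  have R: "0 < R" using radius_pos assms by simp
  have F: "to_radius = at_left R" by (simp add: to_radius_def assms)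
  fix a assume "a < psum_sup \<kappa> R"
  then obtain n where n: "a < ereal (psum \<kappa> n R)" unfolding psum_sup_def less_SUP_iff by blast
  have "((\<lambda>r. ereal (psum \<kappa> n r)) \<longlongrightarrow> ereal (psum \<kappa> n R)) (at_left R)"
    unfolding psum_def by (intro tendsto_intros)
  then have "\<forall>\<^sub>F r in to_radius. a < ereal (psum \<kappa> n r)"
    using n unfolding F by (rule order_tendstoD)
  then show "\<forall>\<^sub>F r in to_radius. a < ereal (gder \<kappa> 1 r)"
    using eventually_to_radius
  proof eventually_elim
    case (elim r)
    then have "psum_sup \<kappa> r = ereal (gder \<kappa> 1 r)" by (simp only: psum_sup_eq_gder less_imp_le)
    then show ?case using less_le_trans[OF elim(1) psum_le_sup] by simp
  qed
next
  fix a assume a: "psum_sup \<kappa> R < a"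
  show "\<forall>\<^sub>F r in to_radius. ereal (gder \<kappa> 1 r) < a"
    using eventually_to_radius
  proof eventually_elim
    case (elim r)
    then have "ereal (gder \<kappa> 1 r) = psum_sup \<kappa> r" by (simp only: psum_sup_eq_gder less_imp_le)
    also have "\<dots> \<le> psum_sup \<kappa> R"
      unfolding psum_sup_def using elim assms by (intro SUP_mono') (auto intro: psum_mono_arg)
    finally show ?case using a by simp
  qed
qed

text \<open>A single monomial with positive coefficient is a lower bound that tends to
  infinity.\<close>

lemma gder_tendsto_infinite:
  assumes "radius \<kappa> = \<infinity>"
  shows "((\<lambda>r. ereal (gder \<kappa> 1 r)) \<longlongrightarrow> \<infinity>) to_radius"
proof -
  obtain i where i: "1 \<le> i" "0 < \<kappa> i" using \<kappa>_pos by blast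
  have F: "to_radius = at_top" by (simp add: to_radius_def assms)
  have "filterlim (\<lambda>r. \<kappa> i * r ^ i) at_top at_top"
    using i by (intro filterlim_tendsto_pos_mult_at_top[OF tendsto_const] filterlim_pow_at_top filterlim_ident) auto
  moreover have "\<forall>\<^sub>F r in at_top. \<kappa> i * r ^ i \<le> gder \<kappa> 1 r"
    using eventually_gt_at_top[of 0]
  proof eventually_elim
    case (elim r)
    have "\<kappa> i * r ^ i \<le> psum \<kappa> i r"
      unfolding psum_def using i \<kappa> elim by (intro member_le_sum) auto
    also have "ereal (psum \<kappa> i r) \<le> ereal (gder \<kappa> 1 r)"
      using psum_le_sup[of i r] psum_sup_eq_gder[of r] elim assms by simp
    then have "psum \<kappa> i r \<le> gder \<kappa> 1 r" by simp
    finally show ?case .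
  qed
  ultimately have "filterlim (gder \<kappa> 1) at_top at_top" by (rule filterlim_at_top_mono)
  then show ?thesis unfolding F by (simp add: tendsto_PInfty_eq_at_top)
qed

lemma gderR_1_finite_radius: "radius \<kappa> = ereal R \<Longrightarrow> gderR \<kappa> 1 = psum_sup \<kappa> R"
  by (intro gderR_eq gder_tendsto_finite)

lemma gderR_1_infinite_radius: "radius \<kappa> = \<infinity> \<Longrightarrow> gderR \<kappa> 1 = \<infinity>"
  by (intro gderR_eq gder_tendsto_infinite)

lemma gder_tendsto_gderR: "((\<lambda>r. ereal (gder \<kappa> 1 r)) \<longlongrightarrow> gderR \<kappa> 1) to_radius"
  using gder_tendsto_finite gder_tendsto_infinite gderR_1_finite_radius gderR_1_infinite_radius radius_pos
  by (cases "radius \<kappa>") auto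

lemma gder_ext_eq_psum_sup:
  assumes "0 < r" "ereal r \<le> radius \<kappa>"
  shows "gder_ext \<kappa> 1 r = psum_sup \<kappa> r"
  using assms psum_sup_eq_gder[of r] gderR_1_finite_radius[of r]
  by (cases "ereal r = radius \<kappa>") (auto simp: gder_ext_def)

section \<open>Existence, uniqueness and value at the point \<open>r_star\<close>\<close>

lemma ex_psum_sup_eq_1:
  assumes "1 < gderR \<kappa> 1"
  shows "\<exists>r>0. ereal r < radius \<kappa> \<and> psum_sup \<kappa> r = 1"
proof -
  have "\<forall>\<^sub>F r in to_radius. 1 < ereal (gder \<kappa> 1 r)"
    using gder_tendsto_gderR assms by (rule order_tendstoD)
  then have "\<forall>\<^sub>F r in to_radius. 1 < ereal (gder \<kappa> 1 r) \<and> 0 < r \<and> ereal r < radius \<kappa>"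
    using eventually_to_radius by (rule eventually_conj)
  then obtain r0 where r0: "1 < gder \<kappa> 1 r0" "0 < r0" "ereal r0 < radius \<kappa>"
    using eventually_happens[of _ to_radius] to_radius_nontrivial by auto
  have lt: "ereal r < radius \<kappa>" if "r \<le> r0" for r
    using that r0(3) by (metis ereal_less_eq(3) le_less_trans)
  have 0: "gder \<kappa> 1 0 = 0" by (simp add: gder_def)
  have "\<forall>r. 0 \<le> r \<and> r \<le> r0 \<longrightarrow> isCont (gder \<kappa> 1) r"
    using lt by (intro allI impI isCont_gder_1) simp
  then have "\<exists>r\<ge>0. r \<le> r0 \<and> gder \<kappa> 1 r = 1"
    using r0 0 by (intro IVT) simp_all
  then obtain r where r: "0 \<le> r" "r \<le> r0" "gder \<kappa> 1 r = 1" by blast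
  then have "r \<noteq> 0" using 0 by auto
  then show ?thesis
    using r lt[of r] psum_sup_eq_gder[of r] by (intro exI[of _ r]) auto
qed

text \<open>If \<open>gderR \<kappa> 1 = 1\<close>, the radius itself solves the equation; above 1
  an interior point does. Strict monotonicity makes the solution unique, which evaluates the
  \<open>THE\<close>.\<close>

lemma r_star_ge_1:
  assumes "1 \<le> gderR \<kappa> 1"
  shows "0 < r_star \<kappa>" "ereal (r_star \<kappa>) \<le> radius \<kappa>" "psum_sup \<kappa> (r_star \<kappa>) = 1"
proof -
  have "\<exists>r>0. ereal r \<le> radius \<kappa> \<and> psum_sup \<kappa> r = 1"
  proof (cases "gderR \<kappa> 1 = 1")
    case True
    then have "radius \<kappa> \<noteq> \<infinity>" using gderR_1_infinite_radius by auto
    then obtain R where R: "radius \<kappa> = ereal R" using radius_pos by (cases "radius \<kappa>") auto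
    then show ?thesis using gderR_1_finite_radius[OF R] True radius_pos by (intro exI[of _ R]) auto
  next
    case False
    then have "1 < gderR \<kappa> 1" using assms by simp
    then show ?thesis using ex_psum_sup_eq_1 less_imp_le by blast
  qed
  then obtain r where r: "0 < r" "ereal r \<le> radius \<kappa>" "psum_sup \<kappa> r = 1" by blast
  have "(THE r. 0 < r \<and> ereal r \<le> radius \<kappa> \<and> gder_ext \<kappa> 1 r = 1) = r"
  proof (rule the_equality)
    show "0 < r \<and> ereal r \<le> radius \<kappa> \<and> gder_ext \<kappa> 1 r = 1" using r gder_ext_eq_psum_sup[of r] by simp
    fix r' assume r': "0 < r' \<and> ereal r' \<le> radius \<kappa> \<and> gder_ext \<kappa> 1 r' = 1"
    then have t: "psum_sup \<kappa> r' = 1" using gder_ext_eq_psum_sup[of r'] by simp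
    show "r' = r"
      using psum_sup_strict_mono[of r r'] psum_sup_strict_mono[of r' r] r r' t
      by (cases r r' rule: linorder_cases) auto
  qed
  then have "r_star \<kappa> = r" using assms by (simp add: r_star_def)
  then show "0 < r_star \<kappa>" "ereal (r_star \<kappa>) \<le> radius \<kappa>" "psum_sup \<kappa> (r_star \<kappa>) = 1"
    using r by auto
qed

text \<open>An infinite radius would force \<open>gderR \<kappa> 1 = \<infinity>\<close>, so
  \<open>real_of_ereal\<close> acts on a finite radius.\<close>

lemma r_star_less_1:
  assumes "gderR \<kappa> 1 < 1"
  shows "0 < r_star \<kappa>" "ereal (r_star \<kappa>) = radius \<kappa>" "psum_sup \<kappa> (r_star \<kappa>) = gderR \<kappa> 1"
proof -
  have "radius \<kappa> \<noteq> \<infinity>" using gderR_1_infinite_radius assms by auto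
  then obtain R where R: "radius \<kappa> = ereal R" using radius_pos by (cases "radius \<kappa>") auto
  moreover from this have "r_star \<kappa> = R" using assms by (simp add: r_star_def not_le[symmetric])
  ultimately show "0 < r_star \<kappa>" "ereal (r_star \<kappa>) = radius \<kappa>" "psum_sup \<kappa> (r_star \<kappa>) = gderR \<kappa> 1"
    using radius_pos gderR_1_finite_radius[OF R] by auto
qed

end

section \<open>From the six hypotheses to the limit at \<open>r_star\<close>\<close>

theorem theorem4p2:
  fixes \<theta> \<kappa> :: "nat \<Rightarrow> real"
  assumes "std_assms \<theta> \<kappa>"
    and "hyp_Sub \<theta> \<kappa> \<or> hyp_Sup1 \<theta> \<kappa> \<or> hyp_Sup0 \<theta> \<kappa> \<or>
         hyp_Crit1 \<theta> \<kappa> \<or> hyp_Crit2 \<theta> \<kappa> \<or> hyp_Crit3 \<theta> \<kappa>"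
  shows "(\<forall>K\<ge>1. (tail_mass \<theta> \<kappa> K \<longlonglongrightarrow> 1 - (\<Sum>j=1..K. \<kappa> j * r_star \<kappa> ^ j)) \<and>
                 nu_tilde \<theta> \<kappa> K = ereal (1 - (\<Sum>j=1..K. \<kappa> j * r_star \<kappa> ^ j)))
         \<and> (gderR \<kappa> 1 \<ge> 1 \<longrightarrow> (\<lambda>K. nu_tilde \<theta> \<kappa> K) \<longlonglongrightarrow> 0)
         \<and> (gderR \<kappa> 1 < 1 \<longrightarrow> (\<lambda>K. nu_tilde \<theta> \<kappa> K) \<longlonglongrightarrow> 1 - gderR \<kappa> 1 \<and> 1 - gderR \<kappa> 1 > 0)"
proof -
  let ?\<rho> = "r_star \<kappa>"
  \<comment> \<open>Under \<open>hyp_Sup0\<close> the second inequality is the radius bound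
    contained in \<open>hol_cont\<close>; in the other cases the radii agree.\<close>
  have rad: "0 < radius \<kappa>" "radius \<kappa> \<le> radius \<theta>"
    using assms(2)
    by (auto simp: hyp_Sub_def hyp_Sup1_def hyp_Sup0_def hyp_Crit1_def hyp_Crit2_def hyp_Crit3_def
        hol_cont_def)
  have nonneg: "0 \<le> \<theta> j" "0 \<le> \<kappa> j" if "1 \<le> j" for j
    using assms(1) that by (auto simp: std_assms_def)
  obtain i where "2 \<le> i" "0 < \<kappa> i" using assms(1) by (auto simp: std_assms_def)
  then interpret nonneg_weights \<kappa>
    using nonneg rad by unfold_locales (auto intro: exI[of _ i])
  have star: "0 < ?\<rho>" "ereal ?\<rho> \<le> radius \<kappa>" "psum_sup \<kappa> ?\<rho> \<le> 1"
    "psum_sup \<kappa> ?\<rho> = 1 \<or> ereal ?\<rho> = radius \<kappa>"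
    using r_star_ge_1 r_star_less_1 by (cases "1 \<le> gderR \<kappa> 1"; force simp: not_le less_imp_le)+
  interpret tilted_weights \<theta> \<kappa> ?\<rho>
  proof
    show "\<exists>j\<ge>1. \<kappa> j \<noteq> 0 \<and> \<not> d dvd j" if "1 < d" for d
      using assms(1) that unfolding std_assms_def by blast
    show "summable (\<lambda>j. gcoeff \<theta> j * r ^ j)" if "0 < r" "r < ?\<rho>" for r
    proof (rule summable_in_conv_radius)
      have "ereal (norm r) < ereal ?\<rho>" using that by simp
      also note star(2)
      also note rad(2)
      finally show "ereal (norm r) < conv_radius (gcoeff \<theta>)" by (simp add: radius_def)
    qed
    show "(\<Sum>j=1..M. \<kappa> j * ?\<rho> ^ j) \<le> 1" for M
      using order_trans[OF psum_le_sup[of M ?\<rho>] star(3)] by (simp add: psum_def one_ereal_def)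
    show "\<exists>M. 1 \<le> (\<Sum>j=1..M. \<kappa> j * r ^ j)" if "?\<rho> < r" for r
    proof -
      \<comment> \<open>Beyond \<open>r_star\<close> the sum exceeds 1: by strict monotonicity if it
        equals 1 there, and because it is infinite if \<open>r_star\<close> is the radius.\<close>
      have "1 < psum_sup \<kappa> r"
        using star(4)
      proof
        assume "psum_sup \<kappa> ?\<rho> = 1"
        then show ?thesis using psum_sup_strict_mono[of ?\<rho> r] star(1) that by auto
      next
        assume "ereal ?\<rho> = radius \<kappa>"
        then have "radius \<kappa> < ereal r" using that by (metis ereal_less_le less_ereal.simps(1))
        then show ?thesis using psum_sup_eq_infinity by simp
      qed
      then obtain M where "1 < ereal (psum \<kappa> M r)" unfolding psum_sup_def less_SUP_iff by blast
      then show ?thesis by (intro exI[of _ M]) (simp add: psum_def one_ereal_def)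
    qed
  qed (use nonneg star(1) in auto)
  have nu: "nu_tilde \<theta> \<kappa> K = ereal (1 - psum \<kappa> K ?\<rho>)" for K
    unfolding nu_tilde_def psum_def
    by (intro lim_imp_Liminf tendsto_ereal tail_mass_limit) simp
  have "(\<lambda>K. ereal (psum \<kappa> K ?\<rho>)) \<longlonglongrightarrow> psum_sup \<kappa> ?\<rho>"
    using star(1) by (intro psum_tendsto_sup) simp
  \<comment> \<open>Finiteness makes the subtraction continuous in the extended reals.\<close>
  moreover have "\<bar>psum_sup \<kappa> ?\<rho>\<bar> \<noteq> \<infinity>" using star(3) psum_sup_nonneg[of ?\<rho>] by auto
  ultimately have "(\<lambda>K. 1 - ereal (psum \<kappa> K ?\<rho>)) \<longlonglongrightarrow> 1 - psum_sup \<kappa> ?\<rho>"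
    by (intro tendsto_diff_ereal tendsto_const) auto
  then have lim: "(\<lambda>K. nu_tilde \<theta> \<kappa> K) \<longlonglongrightarrow> 1 - psum_sup \<kappa> ?\<rho>"
    by (simp add: nu one_ereal_def)
  show ?thesis
  proof (intro conjI allI impI)
    show "tail_mass \<theta> \<kappa> K \<longlonglongrightarrow> 1 - (\<Sum>j=1..K. \<kappa> j * ?\<rho> ^ j)" for K
      by (rule tail_mass_limit)
    show "nu_tilde \<theta> \<kappa> K = ereal (1 - (\<Sum>j=1..K. \<kappa> j * ?\<rho> ^ j))" for K
      using nu[of K] by (simp only: psum_def)
    show "(\<lambda>K. nu_tilde \<theta> \<kappa> K) \<longlonglongrightarrow> 0" if "gderR \<kappa> 1 \<ge> 1"
      using lim r_star_ge_1(3)[OF that] by simp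
    show "(\<lambda>K. nu_tilde \<theta> \<kappa> K) \<longlonglongrightarrow> 1 - gderR \<kappa> 1" if "gderR \<kappa> 1 < 1"
      using lim r_star_less_1(3)[OF that] by simp
    show "1 - gderR \<kappa> 1 > 0" if "gderR \<kappa> 1 < 1"
      using that by (simp add: ereal_diff_gr0)
  qed
qed

end
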